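(* For every $k\ge1$ there are $c,c'>0$ such that the following holds. For every $n\ge k$ and every pair of weighted hypergraphs $w,u:[n]^{(k)}\to\mathbb{R}$, we have $$\operatorname{disc}^+(w,u)\operatorname{disc}^-(w,u)\ge cn^{2k+1}\sum_{i=1}^k n^{-i}W_i^2U_i^2,$$ where $(W_0,\ldots,W_k)$ and $(U_0,\ldots,U_k)$ are the $W$-vectors of $w$ and $u$ respectively. In particular, $$\operatorname{disc}(w,u)\ge c'n^{k+1/2}\sum_{i=1}^kn^{-i/2}W_iU_i.$$
   Context: $[n]=\{1,\ldots,n\}$; $V^{(k)}$ is the family of $k$-subsets of $V$. A weighted $k$-uniform hypergraph on $V$ is a function $w:V^{(k)}\to\mathbb{R}$; $w(S)=\sum_{e\in S^{(k)}}w(e)$, $\langle w,u\rangle=\sum_{e\in V^{(k)}}w(e)u(e)$, $d(w)=w(V)/\binom{|V|}{k}$, and $w_\pi(e)=w(\pi^{-1}(e))$ for a permutation $\pi$ of $V$. With $n=|V|$: $\operatorname{disc}^+(w,u)=\max_\pi\langle w_\pi,u\rangle-d(w)d(u)\binom nk$, $\operatorname{disc}^-(w,u)=d(w)d(u)\binom nk-\min_\pi\langle w_\pi,u\rangle$, $\operatorname{disc}(w,u)=\max\{\operatorname{disc}^+,\operatorname{disc}^-\}$. $W$-vector (defined recursively on $k$): for a weighted $k$-uniform hypergraph $w$ on an $n$-set $V$, $W_0=|w(V)|/\binom nk$ (for $k=0$, $w$ is a single real number on the empty set and $W_0=|w|$). For $k\ge1$ and distinct $x,y\in V$, the difference weighting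 $w^{xy}:(V\setminus\{x,y\})^{(k-1)}\to\mathbb{R}$ is $w^{xy}(e)=w(e\cup\{x\})-w(e\cup\{y\})$; letting $(W^{xy}_0,\ldots,W^{xy}_{k-1})$ be its $W$-vector, define for $1\le i\le k$ $$W_i=\frac{1}{n(n-1)}\sum_{(x,y):\,x\ne y}W^{xy}_{i-1},$$ the average over ordered pairs of distinct vertices. The $W$-vector of $w$ is $(W_0,\ldots,W_k)$. *)

theory Defs
  imports Complex_Main "HOL-Combinatorics.Permutations"
begin

text \<open>k-subsets of V; a weighted k-uniform hypergraph on V is a function on
  sets of vertices, only its values on k-subsets of V matter.\<close>
definition ksub :: "'a set \<Rightarrow> nat \<Rightarrow> 'a set set" where
  "ksub V k = {e. e \<subseteq> V \<and> card e = k}"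

definition wtot :: "'a set \<Rightarrow> nat \<Rightarrow> ('a set \<Rightarrow> real) \<Rightarrow> real" where
  "wtot V k w = (\<Sum>e\<in>ksub V k. w e)"

definition dens :: "'a set \<Rightarrow> nat \<Rightarrow> ('a set \<Rightarrow> real) \<Rightarrow> real" where
  "dens V k w = wtot V k w / real (card V choose k)"

definition diffw :: "('a set \<Rightarrow> real) \<Rightarrow> 'a \<Rightarrow> 'a \<Rightarrow> 'a set \<Rightarrow> real" where
  "diffw w x y e = w (insert x e) - w (insert y e)"

text \<open>Wvec k V w i = W_i of the k-uniform weighted hypergraph w on V (0 <= i <= k).
  Divisions by zero (degenerate cases) evaluate to 0 by Isabelle's convention.\<close>
fun Wvec :: "nat \<Rightarrow> 'a set \<Rightarrow> ('a set \<Rightarrow> real) \<Rightarrow> nat \<Rightarrow> real" where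
  "Wvec k V w 0 = \<bar>wtot V k w\<bar> / real (card V choose k)"
| "Wvec 0 V w (Suc i) = 0"
| "Wvec (Suc k) V w (Suc i) =
     (\<Sum>(x, y)\<in>{(x, y). x \<in> V \<and> y \<in> V \<and> x \<noteq> y}.
        Wvec k (V - {x, y}) (diffw w x y) i)
     / (real (card V) * (real (card V) - 1))"

definition permip :: "'a set \<Rightarrow> nat \<Rightarrow> ('a \<Rightarrow> 'a) \<Rightarrow> ('a set \<Rightarrow> real) \<Rightarrow> ('a set \<Rightarrow> real) \<Rightarrow> real" where
  "permip V k \<pi> w u = (\<Sum>e\<in>ksub V k. w (inv \<pi> ` e) * u e)"

definition disc_plus :: "'a set \<Rightarrow> nat \<Rightarrow> ('a set \<Rightarrow> real) \<Rightarrow> ('a set \<Rightarrow> real) \<Rightarrow> real" where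
  "disc_plus V k w u = Max {permip V k \<pi> w u | \<pi>. \<pi> permutes V}
     - dens V k w * dens V k u * real (card V choose k)"

definition disc_minus :: "'a set \<Rightarrow> nat \<Rightarrow> ('a set \<Rightarrow> real) \<Rightarrow> ('a set \<Rightarrow> real) \<Rightarrow> real" where
  "disc_minus V k w u = dens V k w * dens V k u * real (card V choose k)
     - Min {permip V k \<pi> w u | \<pi>. \<pi> permutes V}"

definition disc :: "'a set \<Rightarrow> nat \<Rightarrow> ('a set \<Rightarrow> real) \<Rightarrow> ('a set \<Rightarrow> real) \<Rightarrow> real" where
  "disc V k w u = max (disc_plus V k w u) (disc_minus V k w u)"

end

theory Submission
  imports Defs "HOL-Library.FuncSet" "HOL-Analysis.Convex"
begin

text \<open>
  Write a random permutation as a pair of random bijections from an index set and divide the indices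
  into pairs. Swapping the indices of some of the pairs turns the overlap of the two hypergraphs into
  a function of degree at most k on a discrete cube. A Fourier coefficient of level i of it is, after
  averaging over everything but the i pairs involved, a product of i-fold differences of the two
  weightings, so its mean absolute value is at least of order n^(k-i) W_i U_i.

  Split the pairs into P and Q. Freezing the swaps in Q, the linear coefficient of a pair in P is a
  low-degree function on the cube of Q. By hypercontractivity its L1 norm is comparable to its L2
  norm, which by Parseval is at least of order n^((i-1)/2) times the typical size of a coefficient of
  level i. Hence the sum L of the absolute values of the linear coefficients over P has mean at least
  of order n^(k-i/2+1/2) W_i U_i.

  Finally bias each swap in P by p times the sign of its linear coefficient. The mean deviation of
  the overlap becomes a polynomial in p of degree at most k which vanishes at 0, has slope E[L]
  there, and lies between - disc^- and disc^+ for p in [-1, 1]. For such a polynomial the squared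
  slope is at most a constant times disc^+ disc^-.
\<close>

section \<open>Bijections and overlaps\<close>

text \<open>Requiring \<open>extensional\<close> fixes the values outside \<open>I\<close>, so each
  bijection is counted once and the set is finite; sums over it divided by a factorial are means
  over a random bijection.\<close>

definition bijs :: "'i set \<Rightarrow> 'a set \<Rightarrow> ('i \<Rightarrow> 'a) set" where
  "bijs I V = {f \<in> extensional I. bij_betw f I V}"

text \<open>When both maps are bijections onto the same set this is \<open>permip\<close> for the
  permutation carrying \<open>\<alpha> i\<close> to \<open>\<beta> i\<close>. Two maps from a common
  index set let the vertex sets differ, as they do once different pairs of vertices have been
  removed from the two sides.\<close>

definition overlap :: "nat \<Rightarrow> 'i set \<Rightarrow> ('a set \<Rightarrow> real) \<Rightarrow> ('b set \<Rightarrow> real)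
    \<Rightarrow> ('i \<Rightarrow> 'a) \<Rightarrow> ('i \<Rightarrow> 'b) \<Rightarrow> real" where
  "overlap k I w u \<alpha> \<beta> = (\<Sum>e\<in>ksub I k. w (\<alpha> ` e) * u (\<beta> ` e))"

lemma finite_ksub: "finite V \<Longrightarrow> finite (ksub V k)"
  by (simp add: ksub_def)

lemma card_ksub: "finite V \<Longrightarrow> card (ksub V k) = card V choose k"
  by (simp add: ksub_def n_subsets)

lemma finite_bijs:
  assumes "finite I" "finite V"
  shows "finite (bijs I V)"
proof (rule finite_subset)
  show "bijs I V \<subseteq> I \<rightarrow>\<^sub>E V"
    by (auto simp: bijs_def PiE_def bij_betw_def)
  show "finite (I \<rightarrow>\<^sub>E V)"
    using assms by (simp add: finite_PiE)
qed

lemma sum_bijs_remove: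
  assumes "finite I" "finite V" "p \<in> I"
  shows "(\<Sum>\<alpha>\<in>bijs I V. f \<alpha>) = (\<Sum>x\<in>V. \<Sum>\<alpha>\<in>bijs (I - {p}) (V - {x}). f (\<alpha>(p := x)))"
proof -
  have "(\<Sum>x\<in>V. \<Sum>\<alpha>\<in>bijs (I - {p}) (V - {x}). f (\<alpha>(p := x)))
      = (\<Sum>(x, \<alpha>)\<in>(SIGMA x:V. bijs (I - {p}) (V - {x})). f (\<alpha>(p := x)))"
    using assms by (subst sum.Sigma) (auto intro: finite_bijs)
  also have "\<dots> = (\<Sum>\<alpha>\<in>bijs I V. f \<alpha>)"
  proof (rule sum.reindex_bij_witness[where i = "\<lambda>\<alpha>. (\<alpha> p, restrict \<alpha> (I - {p}))"
        and j = "\<lambda>(x, \<alpha>). \<alpha>(p := x)"], goal_cases)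
    case (1 a)
    then show ?case
      by (auto simp: bijs_def fun_eq_iff extensional_def)
  next
    case (2 a)
    then obtain x \<alpha> where a: "a = (x, \<alpha>)" "x \<in> V" "bij_betw \<alpha> (I - {p}) (V - {x})"
        "\<alpha> \<in> extensional (I - {p})"
      by (auto simp: bijs_def)
    have "bij_betw (\<alpha>(p := x)) (I - {p}) (V - {x})"
      using a(3) by (subst bij_betw_cong[where g = \<alpha>]) auto
    then have "bij_betw (\<alpha>(p := x)) (insert p (I - {p})) (insert x (V - {x}))"
      using bij_betw_combine[of "\<alpha>(p := x)" "I - {p}" "V - {x}" "{p}" "{x}"]
      by (simp add: bij_betw_def)
    then have "bij_betw (\<alpha>(p := x)) I V"
      using assms(3) a(2) by (simp add: insert_absorb)
    then show ?case
      using a assms(3) by (auto simp: bijs_def extensional_def)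
  next
    case (3 \<alpha>)
    then show ?case
      using assms(3) by (auto simp: fun_eq_iff bijs_def extensional_def)
  next
    case (4 \<alpha>)
    then have "bij_betw \<alpha> I V" by (simp add: bijs_def)
    then have "\<alpha> p \<in> V" "bij_betw \<alpha> (I - {p}) (V - {\<alpha> p})"
      using assms(3) bij_betw_DiffI[of \<alpha> I V "{p}" "{\<alpha> p}"] by (auto simp: bij_betw_def)
    then show ?case
      by (auto simp: bijs_def)
  next
    case (5 a)
    then show ?case by auto
  qed
  finally show ?thesis by simp
qed

lemma card_bijs:
  fixes I :: "'i set" and V :: "'a set"
  assumes "finite I" "finite V" "card I = card V"
  shows "card (bijs I V) = fact (card V)"
  using assms
proof (induction I arbitrary: V rule: finite_induct)
  case empty
  then have V: "V = {}" by simp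
  have "bijs ({} :: 'i set) V = {\<lambda>_. undefined}"
    unfolding V by (auto simp: bijs_def extensional_def bij_betw_def)
  then show ?case by (simp add: V)
next
  case (insert p I)
  from insert.prems insert.hyps have pos: "card V = Suc (card I)" by simp
  have "real (card (bijs (insert p I) V)) = (\<Sum>\<alpha>\<in>bijs (insert p I) V. 1)"
    by simp
  also have "\<dots> = (\<Sum>x\<in>V. \<Sum>\<alpha>\<in>bijs (insert p I - {p}) (V - {x}). 1)"
    using insert by (subst sum_bijs_remove[of _ _ p]) auto
  also have "\<dots> = (\<Sum>x\<in>V. real (fact (card I)))"
  proof (rule sum.cong[OF refl])
    fix x assume "x \<in> V"
    then have "card (bijs I (V - {x})) = fact (card I)"
      using insert pos by (subst insert.IH) auto
    then show "(\<Sum>\<alpha>\<in>bijs (insert p I - {p}) (V - {x}). 1) = real (fact (card I))"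
      using insert.hyps by simp
  qed
  also have "\<dots> = real (fact (card V))"
    using pos by (simp add: algebra_simps)
  finally show ?case by (simp only: of_nat_eq_iff)
qed

lemma bijs_comp:
  assumes "\<alpha> \<in> bijs I V" "s permutes I"
  shows "\<alpha> \<circ> s \<in> bijs I V"
  using assms bij_betw_trans[OF permutes_imp_bij[OF assms(2)], of \<alpha> V]
  by (auto simp: bijs_def extensional_def permutes_def)

lemma sum_bijs_comp:
  assumes "s permutes I"
  shows "(\<Sum>\<alpha>\<in>bijs I V. f (\<alpha> \<circ> s)) = (\<Sum>\<alpha>\<in>bijs I V. f \<alpha>)"
  by (rule sum.reindex_bij_witness[where i = "\<lambda>\<alpha>. \<alpha> \<circ> inv s" and j = "\<lambda>\<alpha>. \<alpha> \<circ> s"])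
    (use assms in \<open>auto simp: o_assoc[symmetric] permutes_inv_o intro: bijs_comp permutes_inv\<close>)

lemma ksub_image_bij:
  assumes "bij_betw f I V"
  shows "bij_betw ((`) f) (ksub I k) (ksub V k)"
proof -
  have inj: "inj_on f I" and im: "f ` I = V" using assms by (auto simp: bij_betw_def)
  have "inj_on ((`) f) (ksub I k)"
    by (rule inj_on_subset[OF inj_on_image_Pow[OF inj]]) (auto simp: ksub_def)
  moreover have "(`) f ` ksub I k = ksub V k"
  proof (intro equalityI subsetI)
    fix e assume "e \<in> (`) f ` ksub I k"
    then obtain d where "d \<subseteq> I" "card d = k" "e = f ` d" by (auto simp: ksub_def)
    then show "e \<in> ksub V k"
      using im card_image[OF inj_on_subset[OF inj]] by (auto simp: ksub_def)
  next
    fix e assume "e \<in> ksub V k"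
    then have e: "e \<subseteq> f ` I" "card e = k" using im by (auto simp: ksub_def)
    then obtain d where d: "d \<subseteq> I" "e = f ` d" by (auto simp: subset_image_iff)
    then have "card d = k"
      using e card_image[OF inj_on_subset[OF inj d(1)]] by simp
    then show "e \<in> (`) f ` ksub I k" using d by (auto simp: ksub_def)
  qed
  ultimately show ?thesis by (simp add: bij_betw_def)
qed

lemma ex_permutes_image:
  assumes "finite I" "d \<in> ksub I k" "e \<in> ksub I k"
  shows "\<exists>s. s permutes I \<and> s ` d = e"
proof -
  have fin: "finite d" "finite e" and sub: "d \<subseteq> I" "e \<subseteq> I" and c: "card d = card e"
    using assms by (auto simp: ksub_def intro: finite_subset)
  obtain f where f: "bij_betw f d e"
    using fin c finite_same_card_bij by blast
  have "card (I - d) = card (I - e)"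
    using fin sub c by (simp add: card_Diff_subset)
  then obtain g where g: "bij_betw g (I - d) (I - e)"
    using assms(1) finite_same_card_bij[of "I - d" "I - e"] by auto
  define s where "s = (\<lambda>x. if x \<in> d then f x else if x \<in> I then g x else x)"
  have "bij_betw s d e"
    using f by (subst bij_betw_cong[where g = f]) (auto simp: s_def)
  moreover have "bij_betw s (I - d) (I - e)"
    using g by (subst bij_betw_cong[where g = g]) (auto simp: s_def)
  ultimately have "bij_betw s (d \<union> (I - d)) (e \<union> (I - e))"
    by (rule bij_betw_combine) auto
  moreover have "d \<union> (I - d) = I" "e \<union> (I - e) = I" using sub by auto
  ultimately have "bij_betw s I I" by simp
  then have "s permutes I"
    by (rule bij_imp_permutes) (use sub in \<open>auto simp: s_def\<close>)
  moreover have "s ` d = e"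
    using \<open>bij_betw s d e\<close> by (simp add: bij_betw_def)
  ultimately show ?thesis by blast
qed

text \<open>By symmetry all k-subsets of \<open>I\<close> give the same sum: a permutation of
  \<open>I\<close> carries any one to any other, and composing with it permutes
  \<open>bijs I V\<close>. Summed over all k-subsets, every bijection contributes
  \<open>wtot V k w\<close>.\<close>

lemma sum_bijs_image:
  assumes "finite I" "finite V" "card I = card V" "e \<in> ksub I k"
  shows "(\<Sum>\<alpha>\<in>bijs I V. w (\<alpha> ` e)) = fact (card V) * dens V k w"
proof -
  let ?c = "card V choose k"
  have eq: "(\<Sum>\<alpha>\<in>bijs I V. w (\<alpha> ` d)) = (\<Sum>\<alpha>\<in>bijs I V. w (\<alpha> ` e))" if d: "d \<in> ksub I k" for d
  proof -
    obtain s where s: "s permutes I" "s ` d = e"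
      using ex_permutes_image assms(1,4) d by blast
    show ?thesis
      using sum_bijs_comp[OF s(1), of "\<lambda>\<alpha>. w (\<alpha> ` d)" V]
      by (simp only: image_comp[symmetric] s(2))
  qed
  have "real ?c * (\<Sum>\<alpha>\<in>bijs I V. w (\<alpha> ` e)) = (\<Sum>d\<in>ksub I k. \<Sum>\<alpha>\<in>bijs I V. w (\<alpha> ` d))"
    using eq card_ksub[OF assms(1)] assms(3) by simp
  also have "\<dots> = (\<Sum>\<alpha>\<in>bijs I V. \<Sum>d\<in>ksub I k. w (\<alpha> ` d))"
    by (rule sum.swap)
  also have "\<dots> = (\<Sum>\<alpha>\<in>bijs I V. wtot V k w)"
    unfolding wtot_def
    by (intro sum.cong refl sum.reindex_bij_betw ksub_image_bij) (simp add: bijs_def)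
  also have "\<dots> = fact (card V) * wtot V k w"
    using card_bijs[OF assms(1-3)] by simp
  finally have *: "real ?c * (\<Sum>\<alpha>\<in>bijs I V. w (\<alpha> ` e)) = fact (card V) * wtot V k w" .
  \<comment> \<open>The given edge \<open>e\<close> forces this, so the division in
    \<open>dens\<close> is a genuine one.\<close>
  have "k \<le> card V"
    using assms card_mono[of I e] by (auto simp: ksub_def)
  then have "real ?c \<noteq> 0" by simp
  with * show ?thesis
    by (simp add: dens_def field_simps)
qed

lemma sum_overlap:
  assumes "finite I" "finite V" "finite U" "card I = card V" "card I = card U"
  shows "(\<Sum>\<alpha>\<in>bijs I V. \<Sum>\<beta>\<in>bijs I U. overlap k I w u \<alpha> \<beta>)
    = (fact (card I))\<^sup>2 * (dens V k w * dens U k u * real (card I choose k))"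
proof -
  have "(\<Sum>\<alpha>\<in>bijs I V. \<Sum>\<beta>\<in>bijs I U. overlap k I w u \<alpha> \<beta>)
      = (\<Sum>\<alpha>\<in>bijs I V. \<Sum>e\<in>ksub I k. \<Sum>\<beta>\<in>bijs I U. w (\<alpha> ` e) * u (\<beta> ` e))"
    unfolding overlap_def by (intro sum.cong refl sum.swap)
  also have "\<dots> = (\<Sum>e\<in>ksub I k. \<Sum>\<alpha>\<in>bijs I V. \<Sum>\<beta>\<in>bijs I U. w (\<alpha> ` e) * u (\<beta> ` e))"
    by (rule sum.swap)
  also have "\<dots> = (\<Sum>e\<in>ksub I k. (fact (card V) * dens V k w) * (fact (card U) * dens U k u))"
    using assms by (intro sum.cong refl)
      (simp flip: sum_distrib_left sum_distrib_right add: sum_bijs_image)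
  also have "\<dots> = (fact (card I))\<^sup>2 * (dens V k w * dens U k u * real (card I choose k))"
    using assms by (simp add: card_ksub power2_eq_square)
  finally show ?thesis .
qed

section \<open>Low-degree functions on the cube\<close>

text \<open>A point of the cube is encoded by the set \<open>J\<close> of its coordinates equal to
  -1 (later the swapped pairs). This is the Walsh character of \<open>S\<close> at that
  point.\<close>

definition chi :: "'j set \<Rightarrow> 'j set \<Rightarrow> real" where
  "chi J S = (-1) ^ card (J \<inter> S)"

definition fourier :: "'j set \<Rightarrow> ('j set \<Rightarrow> real) \<Rightarrow> 'j set \<Rightarrow> real" where
  "fourier K h S = (\<Sum>J\<in>Pow K. chi J S * h J) / 2 ^ card K"

lemma sum_Pow_insert:
  fixes h :: "'j set \<Rightarrow> real"
  assumes "finite K" "j \<notin> K"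
  shows "(\<Sum>J\<in>Pow (insert j K). h J) = (\<Sum>J\<in>Pow K. h J + h (insert j J))"
proof -
  have inj: "inj_on (insert j) (Pow K)"
    using assms(2) by (auto simp: inj_on_def insert_eq_iff)
  have "(\<Sum>J\<in>Pow (insert j K). h J) = (\<Sum>J\<in>Pow K. h J) + (\<Sum>J\<in>insert j ` Pow K. h J)"
    unfolding Pow_insert using assms by (subst sum.union_disjoint) auto
  also have "(\<Sum>J\<in>insert j ` Pow K. h J) = (\<Sum>J\<in>Pow K. h (insert j J))"
    using inj by (simp add: sum.reindex)
  finally show ?thesis by (simp add: sum.distrib)
qed

lemma chi_sym: "chi J S = chi S J"
  by (simp add: chi_def Int_commute)

lemma chi_insert_left:
  assumes "finite J" "j \<notin> J"
  shows "chi (insert j J) S = (if j \<in> S then - chi J S else chi J S)"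
  using assms by (simp add: chi_def Int_insert_left)

lemma chi_insert_right:
  assumes "finite S" "j \<notin> S"
  shows "chi J (insert j S) = (if j \<in> J then - chi J S else chi J S)"
  using chi_insert_left[OF assms, of J] by (simp add: chi_sym)

lemma chi_prod:
  assumes "finite S"
  shows "chi J S = (\<Prod>j\<in>S. if j \<in> J then -1 else 1)"
  using assms
proof (induction S rule: finite_induct)
  case (insert j S)
  then show ?case by (simp add: chi_insert_right)
qed (simp add: chi_def)

lemma chi_empty [simp]: "chi J {} = 1"
  by (simp add: chi_def)

text \<open>The weights describe independent coordinates in {-1, 1} with means \<open>t j\<close>,
  so the mean of a character is the product of the means. Formally the sum factors over
  \<open>K\<close> by \<open>prod_add\<close>, for arbitrary real \<open>t\<close>.\<close>

lemma chi_expectation: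
  assumes "finite K" "S \<subseteq> K"
  shows "(\<Sum>J\<in>Pow K. (\<Prod>j\<in>J. (1 - t j) / 2) * (\<Prod>j\<in>K - J. (1 + t j) / 2) * chi J S)
    = (\<Prod>j\<in>S. t j)"
proof -
  define s where "s j = (if j \<in> S then -1 else 1 :: real)" for j
  have fS: "finite S" using assms finite_subset by blast
  have "(\<Sum>J\<in>Pow K. (\<Prod>j\<in>J. (1 - t j) / 2) * (\<Prod>j\<in>K - J. (1 + t j) / 2) * chi J S)
      = (\<Sum>J\<in>Pow K. (\<Prod>j\<in>J. s j * ((1 - t j) / 2)) * (\<Prod>j\<in>K - J. (1 + t j) / 2))"
  proof (rule sum.cong[OF refl])
    fix J assume "J \<in> Pow K"
    then have "finite J" using assms(1) finite_subset by auto
    then have "chi J S = (\<Prod>j\<in>J. s j)"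
      by (simp add: chi_sym[of J S] chi_prod s_def)
    then show "(\<Prod>j\<in>J. (1 - t j) / 2) * (\<Prod>j\<in>K - J. (1 + t j) / 2) * chi J S
      = (\<Prod>j\<in>J. s j * ((1 - t j) / 2)) * (\<Prod>j\<in>K - J. (1 + t j) / 2)"
      by (simp only: prod.distrib mult_ac)
  qed
  also have "\<dots> = (\<Prod>j\<in>K. s j * ((1 - t j) / 2) + (1 + t j) / 2)"
    using prod_add[OF assms(1), of "\<lambda>j. s j * ((1 - t j) / 2)" "\<lambda>j. (1 + t j) / 2"] by simp
  also have "\<dots> = (\<Prod>j\<in>K. if j \<in> S then t j else 1)"
    by (intro prod.cong refl) (auto simp: s_def field_simps)
  also have "\<dots> = (\<Prod>j\<in>S. t j)"
    using assms by (simp add: prod.If_cases Int_absorb1)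
  finally show ?thesis .
qed

text \<open>This is orthogonality in the dual form, summing over characters for two fixed points.
  The sum factors over \<open>K\<close>, and a coordinate in which the points differ contributes the
  factor 0.\<close>

lemma chi_orthogonal:
  assumes "finite K" "J \<subseteq> K" "J' \<subseteq> K"
  shows "(\<Sum>S\<in>Pow K. chi J S * chi J' S) = (if J = J' then 2 ^ card K else 0)"
proof -
  define s where "s j = (if j \<in> J then -1 else 1 :: real) * (if j \<in> J' then -1 else 1)" for j
  have "(\<Sum>S\<in>Pow K. chi J S * chi J' S) = (\<Sum>S\<in>Pow K. \<Prod>j\<in>S. s j)"
  proof (rule sum.cong[OF refl])
    fix S assume "S \<in> Pow K"
    then have "finite S" using assms(1) finite_subset by auto
    then show "chi J S * chi J' S = (\<Prod>j\<in>S. s j)"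
      by (simp add: chi_prod s_def prod.distrib)
  qed
  also have "\<dots> = (\<Prod>j\<in>K. s j + 1)"
    using prod_add[OF assms(1), of s "\<lambda>_. 1"] by simp
  also have "\<dots> = (if J = J' then 2 ^ card K else 0)"
  proof (cases "J = J'")
    case True
    then have "s j + 1 = 2" for j by (simp add: s_def)
    then show ?thesis using True by simp
  next
    case False
    then obtain j where "j \<in> K" "(j \<in> J) \<noteq> (j \<in> J')" using assms by blast
    then have "j \<in> K \<and> s j + 1 = 0" by (auto simp: s_def)
    then show ?thesis using False assms(1) by (auto intro!: prod_zero)
  qed
  finally show ?thesis .
qed

lemma fourier_inversion:
  assumes "finite K" "J \<subseteq> K"
  shows "h J = (\<Sum>S\<in>Pow K. fourier K h S * chi J S)"
proof -
  have "(\<Sum>S\<in>Pow K. fourier K h S * chi J S)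
      = (\<Sum>S\<in>Pow K. (\<Sum>J'\<in>Pow K. h J' * (chi J S * chi J' S)) / 2 ^ card K)"
    unfolding fourier_def
    by (intro sum.cong refl) (simp add: sum_distrib_left sum_divide_distrib mult_ac)
  also have "\<dots> = (\<Sum>S\<in>Pow K. \<Sum>J'\<in>Pow K. h J' * (chi J S * chi J' S)) / 2 ^ card K"
    by (simp only: sum_divide_distrib)
  also have "(\<Sum>S\<in>Pow K. \<Sum>J'\<in>Pow K. h J' * (chi J S * chi J' S))
      = (\<Sum>J'\<in>Pow K. h J' * (\<Sum>S\<in>Pow K. chi J S * chi J' S))"
    by (subst sum.swap) (simp add: sum_distrib_left)
  also have "\<dots> = (\<Sum>J'\<in>Pow K. if J = J' then h J' * 2 ^ card K else 0)"
    using assms by (intro sum.cong refl) (simp add: chi_orthogonal)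
  also have "\<dots> = h J * 2 ^ card K"
    using assms by (simp add: sum.delta)
  finally show ?thesis by simp
qed

section \<open>Parseval and hypercontractivity by induction on the coordinates\<close>

lemma sum_chi_insert:
  assumes "finite K" "j \<notin> K" "J \<in> Pow K"
  shows "(\<Sum>S\<in>Pow (insert j K). a S * chi J S)
      = (\<Sum>S\<in>Pow K. a S * chi J S) + (\<Sum>S\<in>Pow K. a (insert j S) * chi J S)" (is ?plus)
    and "(\<Sum>S\<in>Pow (insert j K). a S * chi (insert j J) S)
      = (\<Sum>S\<in>Pow K. a S * chi J S) - (\<Sum>S\<in>Pow K. a (insert j S) * chi J S)" (is ?minus)
proof -
  have fin: "finite J" "j \<notin> J" using assms finite_subset by auto
  have fin': "finite S" "j \<notin> S" if "S \<in> Pow K" for S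
    using that assms finite_subset by auto
  show ?plus
    unfolding sum.distrib[symmetric] using assms fin fin'
    by (subst sum_Pow_insert) (auto simp: chi_insert_right intro!: sum.cong)
  show ?minus
    unfolding sum_subtractf[symmetric] using assms fin fin'
    by (subst sum_Pow_insert) (auto simp: chi_insert_right chi_insert_left intro!: sum.cong)
qed

lemma parseval:
  assumes "finite K"
  shows "(\<Sum>J\<in>Pow K. (\<Sum>S\<in>Pow K. a S * chi J S)\<^sup>2) = 2 ^ card K * (\<Sum>S\<in>Pow K. (a S)\<^sup>2)"
  using assms
proof (induction K arbitrary: a rule: finite_induct)
  case empty
  then show ?case by simp
next
  case (insert j K)
  \<comment> \<open>The function is split as A + x_j B with A and B independent of the coordinate
    x_j in {-1, 1}. The squares of A + B and A - B add up to twice those of A and B, without a cross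
    term.\<close>
  define A where "A J = (\<Sum>S\<in>Pow K. a S * chi J S)" for J
  define B where "B J = (\<Sum>S\<in>Pow K. a (insert j S) * chi J S)" for J
  note split = sum_chi_insert[OF insert.hyps, of _ a, folded A_def B_def]
  have "(\<Sum>J\<in>Pow (insert j K). (\<Sum>S\<in>Pow (insert j K). a S * chi J S)\<^sup>2)
     = (\<Sum>J\<in>Pow K. (A J + B J)\<^sup>2 + (A J - B J)\<^sup>2)"
    using insert.hyps split by (subst sum_Pow_insert) simp_all
  also have "\<dots> = 2 * (\<Sum>J\<in>Pow K. (A J)\<^sup>2) + 2 * (\<Sum>J\<in>Pow K. (B J)\<^sup>2)"
    by (simp add: power2_eq_square algebra_simps sum.distrib sum_distrib_left)
  also have "\<dots> = 2 ^ card (insert j K) * (\<Sum>S\<in>Pow K. (a S)\<^sup>2 + (a (insert j S))\<^sup>2)"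
    using insert.hyps unfolding A_def B_def insert.IH by (simp add: algebra_simps sum.distrib)
  also have "(\<Sum>S\<in>Pow K. (a S)\<^sup>2 + (a (insert j S))\<^sup>2) = (\<Sum>S\<in>Pow (insert j K). (a S)\<^sup>2)"
    using insert.hyps by (subst sum_Pow_insert) simp_all
  finally show ?case .
qed

text \<open>The fourth powers of A + B and A - B add up to 2 A^4 + 12 A^2 B^2 + 2 B^4. As B has
  degree one less, its bound is smaller by a factor 9; Cauchy-Schwarz then bounds the mixed term by
  36 a b, exactly the mixed term of 18 (a + b)^2.\<close>

lemma bonami_step:
  fixes A B :: "'b \<Rightarrow> real"
  assumes N: "N > 0"
    and A: "(\<Sum>J\<in>X. A J ^ 4) \<le> N * 9 ^ Suc d * a\<^sup>2" "a \<ge> 0"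
    and B: "(\<Sum>J\<in>X. B J ^ 4) \<le> N * 9 ^ d * b\<^sup>2" "b \<ge> 0"
  shows "(\<Sum>J\<in>X. (A J + B J) ^ 4 + (A J - B J) ^ 4) \<le> 2 * N * 9 ^ Suc d * (a + b)\<^sup>2"
proof -
  have "(\<Sum>J\<in>X. (A J)\<^sup>2 * (B J)\<^sup>2)\<^sup>2 \<le> (\<Sum>J\<in>X. ((A J)\<^sup>2)\<^sup>2) * (\<Sum>J\<in>X. ((B J)\<^sup>2)\<^sup>2)"
    by (rule Cauchy_Schwarz_ineq_sum)
  also have "\<dots> \<le> (N * 9 ^ Suc d * a\<^sup>2) * (N * 9 ^ d * b\<^sup>2)"
    using A B N by (intro mult_mono) (auto intro!: sum_nonneg)
  also have "\<dots> = (N * 3 * 9 ^ d * (a * b))\<^sup>2"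
    by (simp add: power_mult_distrib power2_eq_square algebra_simps)
  finally have AB: "(\<Sum>J\<in>X. (A J)\<^sup>2 * (B J)\<^sup>2) \<le> N * 3 * 9 ^ d * (a * b)"
    by (rule power2_le_imp_le) (use A B N in auto)
  have "(\<Sum>J\<in>X. (A J + B J) ^ 4 + (A J - B J) ^ 4)
      = (\<Sum>J\<in>X. 2 * A J ^ 4 + 12 * ((A J)\<^sup>2 * (B J)\<^sup>2) + 2 * B J ^ 4)"
    by (intro sum.cong refl) (simp add: power4_eq_xxxx power2_eq_square algebra_simps)
  also have "\<dots> = 2 * (\<Sum>J\<in>X. A J ^ 4) + 12 * (\<Sum>J\<in>X. (A J)\<^sup>2 * (B J)\<^sup>2) + 2 * (\<Sum>J\<in>X. B J ^ 4)"
    by (simp add: sum.distrib sum_distrib_left)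
  also have "\<dots> \<le> 2 * (N * 9 ^ Suc d * a\<^sup>2) + 12 * (N * 3 * 9 ^ d * (a * b)) + 2 * (N * 9 ^ d * b\<^sup>2)"
    using A B AB by linarith
  also have "\<dots> = N * 9 ^ d * (18 * a\<^sup>2 + 36 * (a * b) + 2 * b\<^sup>2)"
    by (simp add: algebra_simps)
  also have "\<dots> \<le> N * 9 ^ d * (18 * (a + b)\<^sup>2)"
    using N by (intro mult_left_mono) (auto simp: power2_eq_square algebra_simps)
  also have "\<dots> = 2 * N * 9 ^ Suc d * (a + b)\<^sup>2"
    by simp
  finally show ?thesis .
qed

text \<open>This is the hypercontractive inequality of Bonami: the fourth moment of a function of
  degree at most \<open>d\<close> is at most 9^d times the square of its second moment. The degree
  varies in the induction because the part multiplied by the new coordinate has degree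
  \<open>d - 1\<close>.\<close>

lemma bonami:
  assumes "finite K" "\<And>S. S \<subseteq> K \<Longrightarrow> card S > d \<Longrightarrow> a S = 0"
  shows "(\<Sum>J\<in>Pow K. (\<Sum>S\<in>Pow K. a S * chi J S) ^ 4)
    \<le> 2 ^ card K * 9 ^ d * (\<Sum>S\<in>Pow K. (a S)\<^sup>2)\<^sup>2"
  using assms
proof (induction K arbitrary: a d rule: finite_induct)
  case empty
  have "(a {})\<^sup>2 * (a {})\<^sup>2 \<le> 9 ^ d * ((a {})\<^sup>2 * (a {})\<^sup>2)"
    using mult_right_mono[of 1 "9 ^ d" "(a {})\<^sup>2 * (a {})\<^sup>2"] by simp
  then show ?case by (simp add: power4_eq_xxxx power2_eq_square mult_ac)
next
  case (insert j K)
  define A where "A J = (\<Sum>S\<in>Pow K. a S * chi J S)" for J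
  define B where "B J = (\<Sum>S\<in>Pow K. a (insert j S) * chi J S)" for J
  note split = sum_chi_insert[OF insert.hyps, of _ a, folded A_def B_def]
  have total: "(\<Sum>S\<in>Pow (insert j K). (a S)\<^sup>2)
      = (\<Sum>S\<in>Pow K. (a S)\<^sup>2) + (\<Sum>S\<in>Pow K. (a (insert j S))\<^sup>2)"
    using insert.hyps by (subst sum_Pow_insert) (simp_all add: sum.distrib)
  have lhs: "(\<Sum>J\<in>Pow (insert j K). (\<Sum>S\<in>Pow (insert j K). a S * chi J S) ^ 4)
     = (\<Sum>J\<in>Pow K. (A J + B J) ^ 4 + (A J - B J) ^ 4)"
    using insert.hyps split by (subst sum_Pow_insert) simp_all
  have boundA: "(\<Sum>J\<in>Pow K. A J ^ 4) \<le> 2 ^ card K * 9 ^ d * (\<Sum>S\<in>Pow K. (a S)\<^sup>2)\<^sup>2"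
    unfolding A_def by (rule insert.IH) (use insert.prems in auto)
  have card_ins: "card (insert j S) = Suc (card S)" if "S \<subseteq> K" for S
    using that insert.hyps finite_subset by (intro card_insert_disjoint) auto
  show ?case
  proof (cases d)
    \<comment> \<open>A function of degree 0 does not depend on the coordinate \<open>j\<close>, so
      \<open>B\<close> vanishes.\<close>
    case 0
    have a0: "a (insert j S) = 0" if "S \<subseteq> K" for S
      using insert.prems[of "insert j S"] that card_ins[OF that] 0 by auto
    then have "B J = 0" for J by (simp add: B_def)
    then show ?thesis
      using boundA a0 insert.hyps unfolding lhs total by (simp add: 0 flip: sum_distrib_left)
  next
    case (Suc d')
    have boundB: "(\<Sum>J\<in>Pow K. B J ^ 4) \<le> 2 ^ card K * 9 ^ d' * (\<Sum>S\<in>Pow K. (a (insert j S))\<^sup>2)\<^sup>2"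
      unfolding B_def
      
    proof (rule insert.IH)
      fix S assume S: "S \<subseteq> K" "d' < card S"
      then show "a (insert j S) = 0"
        by (intro insert.prems) (auto simp: Suc card_ins)
    qed
    show ?thesis
      unfolding lhs total Suc
      using bonami_step[OF _ boundA[unfolded Suc] _ boundB] insert.hyps
      by (simp add: sum_nonneg mult_ac)
  qed
qed

text \<open>For s = |t| / l this is s^2 - s^4 \<le> s. Averaged, it bounds a first absolute moment
  below by the second and fourth moments, with the scale \<open>l\<close> left free.\<close>

lemma abs_ge_square_minus_fourth:
  fixes t l :: real
  assumes "l > 0"
  shows "t\<^sup>2 / l - t ^ 4 / l ^ 3 \<le> \<bar>t\<bar>"
proof -
  define s where "s = \<bar>t\<bar> / l"
  have s: "s \<ge> 0" using assms by (simp add: s_def)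
  have "s\<^sup>2 - s ^ 4 \<le> s"
  proof (cases "s \<le> 1")
    case True
    then have "s\<^sup>2 \<le> s" using s by (simp add: power2_eq_square mult_left_le)
    then show ?thesis using zero_le_power[OF s, of 4] by linarith
  next
    case False
    then have "s\<^sup>2 \<le> s ^ 4" by (intro power_increasing) auto
    then show ?thesis using s by linarith
  qed
  then have "l * (s\<^sup>2 - s ^ 4) \<le> l * s" using assms by simp
  moreover have "l * s\<^sup>2 = t\<^sup>2 / l" "l * s ^ 4 = t ^ 4 / l ^ 3" "l * s = \<bar>t\<bar>"
    using assms by (simp_all add: s_def power_divide power2_eq_square power3_eq_cube power4_eq_xxxx)
  ultimately show ?thesis by (simp add: right_diff_distrib)
qed

text \<open>Parseval gives the second moment, \<open>bonami\<close> bounds the fourth, and the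
  pointwise inequality above turns both into a lower bound for the L1 norm.\<close>

lemma khinchine_low_degree:
  assumes "finite K" "\<And>S. S \<subseteq> K \<Longrightarrow> card S > d \<Longrightarrow> a S = 0"
  shows "2 ^ card K * sqrt (\<Sum>S\<in>Pow K. (a S)\<^sup>2)
    \<le> 3 ^ Suc d * (\<Sum>J\<in>Pow K. \<bar>\<Sum>S\<in>Pow K. a S * chi J S\<bar>)"
proof -
  define V where "V = (\<Sum>S\<in>Pow K. (a S)\<^sup>2)"
  define h where "h J = (\<Sum>S\<in>Pow K. a S * chi J S)" for J
  have V0: "V \<ge> 0" by (simp add: V_def sum_nonneg)
  show ?thesis
  proof (cases "V = 0")
    case True
    then show ?thesis by (simp add: V_def[symmetric] sum_nonneg)
  next
    case False
    with V0 have V: "V > 0" by simp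
    define r where "r = sqrt V"
    have r: "r > 0" "V = r\<^sup>2" using V by (auto simp: r_def)
    \<comment> \<open>At this scale the fourth-moment term is at most 4/9 of the second-moment term,
      so 5/9 of it survives. The resulting constant 2/3 * 5/9 = 10/27 exceeds 1/3, which explains
      the extra factor 3 in \<open>3 ^ Suc d\<close>.\<close>
    define l where "l = 3 / 2 * 3 ^ d * r"
    have l: "l > 0" using r by (simp add: l_def)
    have l2: "l\<^sup>2 = 9 / 4 * (9 ^ d * V)"
      by (simp add: l_def r(2) power_mult_distrib power2_eq_square flip: power_mult_distrib)
    have sq: "(\<Sum>J\<in>Pow K. (h J)\<^sup>2) = 2 ^ card K * V"
      unfolding h_def V_def by (rule parseval[OF assms(1)])
    have fourth: "(\<Sum>J\<in>Pow K. h J ^ 4) \<le> 2 ^ card K * 9 ^ d * V\<^sup>2"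
      unfolding h_def V_def by (rule bonami[OF assms])
    have "2 ^ card K * r \<le> 3 ^ Suc d * (2 ^ card K * (V / l) * (5 / 9))"
    proof -
      have "V / l = r / (3 / 2 * 3 ^ d)"
        using r by (simp add: l_def power2_eq_square)
      then show ?thesis using r by (simp only:) (simp add: field_simps)
    qed
    also have "2 ^ card K * (V / l) * (5 / 9) = 2 ^ card K * V / l - 2 ^ card K * 9 ^ d * V\<^sup>2 / l ^ 3"
    proof -
      have "9 ^ d * V\<^sup>2 / l ^ 3 = (9 ^ d * V) * V / (l\<^sup>2 * l)"
        by (simp add: power2_eq_square power3_eq_cube)
      also have "\<dots> = 4 / 9 * (V / l)"
        unfolding l2 using V by simp
      finally have "2 ^ card K * (9 ^ d * V\<^sup>2 / l ^ 3) = 2 ^ card K * (4 / 9 * (V / l))" by simp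
      then show ?thesis by (simp only: mult.assoc times_divide_eq_right) (simp add: field_simps)
    qed
    also have "\<dots> \<le> (\<Sum>J\<in>Pow K. (h J)\<^sup>2) / l - (\<Sum>J\<in>Pow K. h J ^ 4) / l ^ 3"
      using fourth l unfolding sq by (intro diff_mono divide_right_mono) auto
    also have "\<dots> = (\<Sum>J\<in>Pow K. (h J)\<^sup>2 / l - h J ^ 4 / l ^ 3)"
      by (simp add: sum_subtractf sum_divide_distrib)
    also have "\<dots> \<le> (\<Sum>J\<in>Pow K. \<bar>h J\<bar>)"
      using l by (intro sum_mono abs_ge_square_minus_fourth)
    finally show ?thesis
      unfolding r_def V_def h_def by simp
  qed
qed

section \<open>Fourier coefficients of the overlap\<close>

text \<open>Pair j consists of the indices 2j and 2j + 1.\<close>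

definition swap_pairs :: "nat set \<Rightarrow> nat \<Rightarrow> nat" where
  "swap_pairs J i = (if i div 2 \<in> J then if even i then i + 1 else i - 1 else i)"

lemma swap_pairs_div [simp]: "swap_pairs J i div 2 = i div 2"
  by (auto simp: swap_pairs_def elim!: oddE)

lemma swap_pairs_invol [simp]: "swap_pairs J (swap_pairs J i) = i"
  by (auto simp: swap_pairs_def elim!: oddE)

lemma swap_pairs_Un:
  assumes "J \<inter> J' = {}"
  shows "swap_pairs J \<circ> swap_pairs J' = swap_pairs (J \<union> J')"
proof
  fix i
  show "(swap_pairs J \<circ> swap_pairs J') i = swap_pairs (J \<union> J') i"
  proof (cases "i div 2 \<in> J")
    case True
    then have "i div 2 \<notin> J'" using assms by auto
    with True show ?thesis by (simp add: swap_pairs_def)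
  next
    case False
    have "swap_pairs J' i div 2 \<notin> J" using False by simp
    then have "swap_pairs J (swap_pairs J' i) = swap_pairs J' i"
      by (simp only: swap_pairs_def if_False)
    with False show ?thesis by (simp add: swap_pairs_def)
  qed
qed

lemma swap_pairs_permutes:
  assumes "\<And>j. j \<in> J \<Longrightarrow> {2 * j, 2 * j + 1} \<subseteq> I"
  shows "swap_pairs J permutes I"
proof -
  have "swap_pairs J i = i" if "i \<notin> I" for i
  proof -
    have "i = 2 * (i div 2) \<or> i = 2 * (i div 2) + 1" by presburger
    then have "i div 2 \<notin> J" using assms[of "i div 2"] that by auto
    then show ?thesis by (simp add: swap_pairs_def)
  qed
  moreover have "\<exists>!x. swap_pairs J x = y" for y
    by (rule ex1I[of _ "swap_pairs J y"]) auto
  ultimately show ?thesis by (simp add: permutes_def)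
qed

section \<open>Swapping one pair as a difference operator\<close>

lemma sum_ksub_Suc_pair:
  fixes t :: "'i set \<Rightarrow> real"
  assumes I: "finite I" "p \<in> I" "q \<in> I" "p \<noteq> q"
    and t: "\<And>e. e \<in> ksub I (Suc k) \<Longrightarrow> p \<in> e \<longleftrightarrow> q \<in> e \<Longrightarrow> t e = 0"
  shows "(\<Sum>e\<in>ksub I (Suc k). t e)
    = (\<Sum>e\<in>ksub (I - {p, q}) k. t (insert p e) + t (insert q e))"
proof -
  let ?E = "ksub (I - {p, q}) k"
  have fin: "finite e" "p \<notin> e" "q \<notin> e" if "e \<in> ?E" for e
    using that I(1) by (auto simp: ksub_def intro: finite_subset)
  have inj: "inj_on (insert p) ?E" "inj_on (insert q) ?E"
  proof -
    have "inj_on (insert r) ?E" if "r \<in> {p, q}" for r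
    proof (rule inj_onI)
      fix d e assume "d \<in> ?E" "e \<in> ?E" "insert r d = insert r e"
      then show "d = e"
        using insert_ident[of r d e] fin[of d] fin[of e] that by auto
    qed
    then show "inj_on (insert p) ?E" "inj_on (insert q) ?E" by auto
  qed
  have "(\<Sum>e\<in>ksub I (Suc k). t e) = (\<Sum>e\<in>insert p ` ?E \<union> insert q ` ?E. t e)"
  proof (rule sum.mono_neutral_right)
    show "insert p ` ?E \<union> insert q ` ?E \<subseteq> ksub I (Suc k)"
    proof
      fix e assume "e \<in> insert p ` ?E \<union> insert q ` ?E"
      then obtain d r where "d \<in> ?E" "r \<in> {p, q}" "e = insert r d" by blast
      then show "e \<in> ksub I (Suc k)"
        using fin[of d] I(2,3) by (auto simp: ksub_def)
    qed
    show "\<forall>e\<in>ksub I (Suc k) - (insert p ` ?E \<union> insert q ` ?E). t e = 0"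
    proof
      fix e assume e: "e \<in> ksub I (Suc k) - (insert p ` ?E \<union> insert q ` ?E)"
      then have fe: "finite e" using I(1) by (auto simp: ksub_def intro: finite_subset)
      have "p \<in> e \<longleftrightarrow> q \<in> e"
      proof (rule ccontr)
        assume "\<not> (p \<in> e \<longleftrightarrow> q \<in> e)"
        then consider "p \<in> e" "q \<notin> e" | "q \<in> e" "p \<notin> e" by blast
        then show False
        proof cases
          case 1
          then have "e - {p} \<in> ?E" "e = insert p (e - {p})" using e fe by (auto simp: ksub_def)
          then show False using e by blast
        next
          case 2
          then have "e - {q} \<in> ?E" "e = insert q (e - {q})" using e fe by (auto simp: ksub_def)
          then show False using e by blast
        qed
      qed
      then show "t e = 0" using e t by blast
    qed
  qed (use I finite_ksub in auto)
  also have "\<dots> = (\<Sum>e\<in>insert p ` ?E. t e) + (\<Sum>e\<in>insert q ` ?E. t e)"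
    using I fin by (intro sum.union_disjoint) (auto intro!: finite_ksub finite_imageI)
  also have "\<dots> = (\<Sum>e\<in>?E. t (insert p e) + t (insert q e))"
    using inj by (simp add: sum.reindex sum.distrib)
  finally show ?thesis .
qed

text \<open>Only edges with exactly one index of pair \<open>j\<close> feel its swap. For a rest
  \<open>e\<close>, the two such edges contribute a difference of \<open>w\<close> times u(e + a)
  and the negative of that difference times u(e + b), hence a product of two differences.\<close>

lemma overlap_swap_diff:
  fixes w :: "'a set \<Rightarrow> real" and u :: "'b set \<Rightarrow> real" and \<alpha>' :: "nat \<Rightarrow> 'a" and \<beta>' :: "nat \<Rightarrow> 'b"
    and x y :: 'a and a b :: 'b
  assumes I: "finite I" "{2 * j, 2 * j + 1} \<subseteq> I" and j: "j \<notin> J"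
    and J: "\<And>j. j \<in> J \<Longrightarrow> {2 * j, 2 * j + 1} \<subseteq> I"
  defines "\<alpha> \<equiv> \<alpha>'(2 * j + 1 := y, 2 * j := x)" and "\<beta> \<equiv> \<beta>'(2 * j + 1 := b, 2 * j := a)"
  shows "overlap (Suc k) I w u (\<alpha> \<circ> swap_pairs J) \<beta>
      - overlap (Suc k) I w u (\<alpha> \<circ> swap_pairs (insert j J)) \<beta>
    = overlap k (I - {2 * j, 2 * j + 1}) (diffw w x y) (diffw u a b) (\<alpha>' \<circ> swap_pairs J) \<beta>'"
proof -
  let ?p = "2 * j" and ?q = "2 * j + 1"
  let ?s = "swap_pairs J" and ?s' = "swap_pairs (insert j J)"
  define t where "t e = (w ((\<alpha> \<circ> ?s) ` e) - w ((\<alpha> \<circ> ?s') ` e)) * u (\<beta> ` e)" for e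
  have other: "?s' i = ?s i" if "i \<noteq> ?p" "i \<noteq> ?q" for i
  proof -
    have "i div 2 \<noteq> j" using that by presburger
    then show ?thesis by (simp add: swap_pairs_def)
  qed
  have pq: "?s ?p = ?p" "?s ?q = ?q" "?s' ?p = ?q" "?s' ?q = ?p"
    using j by (auto simp: swap_pairs_def)
  \<comment> \<open>An edge with both indices of the pair, or with neither, has the same image
    before and after the swap.\<close>
  have zero: "t e = 0" if "?p \<in> e \<longleftrightarrow> ?q \<in> e" for e
  proof -
    have "?s' ` e = ?s ` e"
    proof (cases "?p \<in> e")
      case True
      define d where "d = e - {?p, ?q}"
      have e: "e = insert ?p (insert ?q d)" using True that by (auto simp: d_def)
      have d: "?s' ` d = ?s ` d"
        using other by (intro image_cong) (auto simp: d_def)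
      show ?thesis
        unfolding e image_insert pq d by (rule insert_commute)
    next
      case False
      then show ?thesis using that by (intro image_cong refl other) auto
    qed
    then show ?thesis by (simp only: t_def image_comp[symmetric] diff_self mult_zero_left)
  qed
  have "overlap (Suc k) I w u (\<alpha> \<circ> ?s) \<beta> - overlap (Suc k) I w u (\<alpha> \<circ> ?s') \<beta>
      = (\<Sum>e\<in>ksub I (Suc k). t e)"
    by (simp add: overlap_def t_def sum_subtractf left_diff_distrib)
  also have "\<dots> = (\<Sum>e\<in>ksub (I - {?p, ?q}) k. t (insert ?p e) + t (insert ?q e))"
    using I zero by (intro sum_ksub_Suc_pair) auto
  also have "\<dots> = (\<Sum>e\<in>ksub (I - {?p, ?q}) k.
      diffw w x y ((\<alpha>' \<circ> ?s) ` e) * diffw u a b (\<beta>' ` e))"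
  proof (rule sum.cong[OF refl])
    fix e assume "e \<in> ksub (I - {?p, ?q}) k"
    then have e: "?p \<notin> e" "?q \<notin> e" by (auto simp: ksub_def)
    have fix1: "?s i \<noteq> ?p \<and> ?s i \<noteq> ?q" if "i \<in> e" for i
      by (metis pq(1,2) swap_pairs_invol e that)
    have im: "(\<alpha> \<circ> ?s) ` e = (\<alpha>' \<circ> ?s) ` e" "(\<alpha> \<circ> ?s') ` e = (\<alpha>' \<circ> ?s) ` e" "\<beta> ` e = \<beta>' ` e"
    proof -
      have "?s' i = ?s i" if "i \<in> e" for i
        using e that by (intro other) auto
      then show "(\<alpha> \<circ> ?s) ` e = (\<alpha>' \<circ> ?s) ` e" "(\<alpha> \<circ> ?s') ` e = (\<alpha>' \<circ> ?s) ` e"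
        using fix1 by (auto simp: \<alpha>_def intro!: image_cong)
      show "\<beta> ` e = \<beta>' ` e"
        using e by (intro image_cong refl) (auto simp: \<beta>_def)
    qed
    have "\<alpha> ?p = x" "\<alpha> ?q = y" "\<beta> ?p = a" "\<beta> ?q = b"
      by (simp_all add: \<alpha>_def \<beta>_def)
    then show "t (insert ?p e) + t (insert ?q e)
        = diffw w x y ((\<alpha>' \<circ> ?s) ` e) * diffw u a b (\<beta>' ` e)"
      unfolding t_def image_insert im o_apply pq diffw_def by (simp add: algebra_simps)
  qed
  finally show ?thesis by (simp add: overlap_def)
qed

definition distinct_pairs :: "'a set \<Rightarrow> ('a \<times> 'a) set" where
  "distinct_pairs V = {(x, y). x \<in> V \<and> y \<in> V \<and> x \<noteq> y}"

lemma distinct_pairs_Sigma: "distinct_pairs V = (SIGMA x:V. V - {x})"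
  by (auto simp: distinct_pairs_def)

text \<open>Classifying bijections by the images of \<open>p\<close> and \<open>q\<close> produces
  the ordered pairs of distinct vertices over which the W-vector averages.\<close>

lemma sum_bijs_remove_pair:
  assumes "finite I" "finite V" "p \<in> I" "q \<in> I" "p \<noteq> q"
  shows "(\<Sum>\<alpha>\<in>bijs I V. f \<alpha>)
    = (\<Sum>(x, y)\<in>distinct_pairs V. \<Sum>\<alpha>\<in>bijs (I - {p, q}) (V - {x, y}). f (\<alpha>(q := y, p := x)))"
proof -
  have "(\<Sum>\<alpha>\<in>bijs I V. f \<alpha>) = (\<Sum>x\<in>V. \<Sum>\<alpha>\<in>bijs (I - {p}) (V - {x}). f (\<alpha>(p := x)))"
    using assms by (rule_tac sum_bijs_remove) auto
  also have "\<dots> = (\<Sum>x\<in>V. \<Sum>y\<in>V - {x}.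
      \<Sum>\<alpha>\<in>bijs (I - {p} - {q}) (V - {x} - {y}). f (\<alpha>(q := y, p := x)))"
    using assms by (intro sum.cong refl sum_bijs_remove) auto
  also have "\<dots> = (\<Sum>(x, y)\<in>distinct_pairs V.
      \<Sum>\<alpha>\<in>bijs (I - {p} - {q}) (V - {x} - {y}). f (\<alpha>(q := y, p := x)))"
    unfolding distinct_pairs_Sigma using assms by (subst sum.Sigma) auto
  also have "\<dots> = (\<Sum>(x, y)\<in>distinct_pairs V.
      \<Sum>\<alpha>\<in>bijs (I - {p, q}) (V - {x, y}). f (\<alpha>(q := y, p := x)))"
    by (simp add: Diff_insert[symmetric] insert_commute)
  finally show ?thesis .
qed

text \<open>Composing with a swap permutes \<open>bijs I V\<close>, so each of the 2^|K| choices of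
  \<open>J\<close> contributes the same total.\<close>

lemma sum_overlap_swaps:
  assumes "finite I" "finite V" "finite U" "card I = card V" "card I = card U"
    "finite K" "\<And>j. j \<in> K \<Longrightarrow> {2 * j, 2 * j + 1} \<subseteq> I"
  shows "(\<Sum>\<alpha>\<in>bijs I V. \<Sum>\<beta>\<in>bijs I U. \<Sum>J\<in>Pow K. overlap k I w u (\<alpha> \<circ> swap_pairs J) \<beta>)
    = 2 ^ card K * (fact (card I))\<^sup>2 * (dens V k w * dens U k u * real (card I choose k))"
proof -
  have perm: "swap_pairs J permutes I" if "J \<in> Pow K" for J
    using that assms(7) by (intro swap_pairs_permutes) blast
  have "(\<Sum>\<alpha>\<in>bijs I V. \<Sum>\<beta>\<in>bijs I U. \<Sum>J\<in>Pow K. overlap k I w u (\<alpha> \<circ> swap_pairs J) \<beta>)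
      = (\<Sum>\<alpha>\<in>bijs I V. \<Sum>J\<in>Pow K. \<Sum>\<beta>\<in>bijs I U. overlap k I w u (\<alpha> \<circ> swap_pairs J) \<beta>)"
    by (intro sum.cong refl sum.swap)
  also have "\<dots> = (\<Sum>J\<in>Pow K. \<Sum>\<alpha>\<in>bijs I V. \<Sum>\<beta>\<in>bijs I U. overlap k I w u (\<alpha> \<circ> swap_pairs J) \<beta>)"
    by (rule sum.swap)
  also have "\<dots> = (\<Sum>J\<in>Pow K. \<Sum>\<alpha>\<in>bijs I V. \<Sum>\<beta>\<in>bijs I U. overlap k I w u \<alpha> \<beta>)"
  proof (rule sum.cong[OF refl])
    fix J assume "J \<in> Pow K"
    then show "(\<Sum>\<alpha>\<in>bijs I V. \<Sum>\<beta>\<in>bijs I U. overlap k I w u (\<alpha> \<circ> swap_pairs J) \<beta>)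
        = (\<Sum>\<alpha>\<in>bijs I V. \<Sum>\<beta>\<in>bijs I U. overlap k I w u \<alpha> \<beta>)"
      using sum_bijs_comp[OF perm, of J "\<lambda>\<alpha>. \<Sum>\<beta>\<in>bijs I U. overlap k I w u \<alpha> \<beta>" V] by simp
  qed
  also have "\<dots> = 2 ^ card K * (fact (card I))\<^sup>2 * (dens V k w * dens U k u * real (card I choose k))"
    using assms by (subst sum_overlap) (simp_all add: card_Pow)
  finally show ?thesis .
qed

text \<open>Peeling one pair of S off the index set replaces both weightings by their difference weightings
  at the images of that pair, so averaging over these images reproduces the recursion of the
  W-vector; what remains for empty S is the mean of the overlap.\<close>

lemma sum_fourier_overlap_ge:
  fixes w :: "'a set \<Rightarrow> real" and u :: "'b set \<Rightarrow> real"
  assumes "finite S" "finite I" "finite V" "finite U" "card I = card V" "card I = card U"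
    "finite K" "\<And>j. j \<in> K \<Longrightarrow> {2 * j, 2 * j + 1} \<subseteq> I" "S \<subseteq> K" "card S \<le> k"
  shows "2 ^ (card K - card S) * real ((card I - 2 * card S) choose (k - card S)) * (fact (card I))\<^sup>2
      * (Wvec k V w (card S) * Wvec k U u (card S))
    \<le> (\<Sum>\<alpha>\<in>bijs I V. \<Sum>\<beta>\<in>bijs I U.
        \<bar>\<Sum>J\<in>Pow K. chi J S * overlap k I w u (\<alpha> \<circ> swap_pairs J) \<beta>\<bar>)"
  using assms
proof (induction S arbitrary: K I V U k w u rule: finite_induct)
  case empty
  define D where "D = dens V k w * dens U k u * real (card I choose k)"
  \<comment> \<open>For empty \<open>S\<close> the claim is the triangle inequality:
    \<open>W_0\<close> and \<open>U_0\<close> are the absolute values of the densities, which occur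
    in the total of the overlap.\<close>
  have total: "(\<Sum>\<alpha>\<in>bijs I V. \<Sum>\<beta>\<in>bijs I U. \<Sum>J\<in>Pow K. overlap k I w u (\<alpha> \<circ> swap_pairs J) \<beta>)
      = 2 ^ card K * (fact (card I))\<^sup>2 * D"
    unfolding D_def by (rule sum_overlap_swaps) (use empty.prems in auto)
  have "2 ^ (card K - card {}) * real ((card I - 2 * card {}) choose (k - card {})) * (fact (card I))\<^sup>2
      * (Wvec k V w (card {}) * Wvec k U u (card {})) = \<bar>2 ^ card K * (fact (card I))\<^sup>2 * D\<bar>"
    by (simp add: D_def abs_mult dens_def)
  also have "\<dots> \<le> (\<Sum>\<alpha>\<in>bijs I V. \<Sum>\<beta>\<in>bijs I U.
      \<bar>\<Sum>J\<in>Pow K. overlap k I w u (\<alpha> \<circ> swap_pairs J) \<beta>\<bar>)"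
    unfolding total[symmetric] by (rule order_trans[OF sum_abs sum_mono]) (rule sum_abs)
  finally show ?case by (simp add: comp_def)
next
  case (insert j S)
  obtain k' where k: "k = Suc k'" "card S \<le> k'"
    using insert.prems(9) insert.hyps by (cases k) auto
  let ?p = "2 * j" and ?q = "2 * j + 1" and ?i = "card S"
  define n where "n = card I"
  define K' where "K' = K - {j}"
  define I' where "I' = I - {?p, ?q}"
  have j: "j \<in> K" and SK': "S \<subseteq> K'" using insert.prems insert.hyps by (auto simp: K'_def)
  then have pq: "{?p, ?q} \<subseteq> I" using insert.prems(7)[of j] by auto
  have K: "K = insert j K'" "j \<notin> K'" "finite K'" using j insert.prems by (auto simp: K'_def)
  have n2: "2 \<le> n"
    using card_mono[OF insert.prems(1) pq] by (simp add: n_def)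
  have cI': "card I' = n - 2" "finite I'"
    using pq insert.prems(1) by (auto simp: I'_def n_def card_Diff_subset)
  have pairsK': "{2 * j', 2 * j' + 1} \<subseteq> I'" if "j' \<in> K'" for j'
  proof -
    have "j' \<in> K" "j' \<noteq> j" using that by (auto simp: K'_def)
    then show ?thesis using insert.prems(7)[of j'] unfolding I'_def by auto
  qed
  define c where "c = 2 ^ (card K' - ?i) * real ((card I' - 2 * ?i) choose (k' - ?i)) * (fact (card I'))\<^sup>2"
  \<comment> \<open>The sets \<open>J\<close> and \<open>insert j J\<close> carry opposite signs, so
    together they give the difference computed in \<open>overlap_swap_diff\<close>; the other pairs
    of \<open>S\<close> are left to the induction hypothesis.\<close>
  have step: "\<bar>\<Sum>J\<in>Pow K. chi J (insert j S)
        * overlap k I w u (\<alpha>(?q := y, ?p := x) \<circ> swap_pairs J) (\<beta>(?q := b, ?p := a))\<bar>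
      = \<bar>\<Sum>J\<in>Pow K'. chi J S
        * overlap k' I' (diffw w x y) (diffw u a b) (\<alpha> \<circ> swap_pairs J) \<beta>\<bar>" for \<alpha> \<beta> x y a b
  proof -
    have "(\<Sum>J\<in>Pow K. chi J (insert j S)
        * overlap k I w u (\<alpha>(?q := y, ?p := x) \<circ> swap_pairs J) (\<beta>(?q := b, ?p := a)))
      = (\<Sum>J\<in>Pow K'. chi J S
        * overlap k' I' (diffw w x y) (diffw u a b) (\<alpha> \<circ> swap_pairs J) \<beta>)"
      unfolding K(1) sum_Pow_insert[OF K(3,2)]
    proof (rule sum.cong[OF refl])
      fix J assume "J \<in> Pow K'"
      then have J: "finite J" "j \<notin> J" "\<And>j. j \<in> J \<Longrightarrow> {2 * j, 2 * j + 1} \<subseteq> I"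
        using K finite_subset insert.prems(7) by blast+
      have c1: "chi J (insert j S) = chi J S" "chi (insert j J) (insert j S) = - chi J S"
        using J insert.hyps by (simp_all add: chi_insert_right chi_insert_left)
      have D: "overlap (Suc k') I w u (\<alpha>(?q := y, ?p := x) \<circ> swap_pairs J) (\<beta>(?q := b, ?p := a))
          - overlap (Suc k') I w u (\<alpha>(?q := y, ?p := x) \<circ> swap_pairs (insert j J)) (\<beta>(?q := b, ?p := a))
          = overlap k' I' (diffw w x y) (diffw u a b) (\<alpha> \<circ> swap_pairs J) \<beta>"
        unfolding I'_def by (rule overlap_swap_diff[OF insert.prems(1) pq J(2)]) (rule J(3))
      show "chi J (insert j S)
          * overlap k I w u (\<alpha>(?q := y, ?p := x) \<circ> swap_pairs J) (\<beta>(?q := b, ?p := a))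
        + chi (insert j J) (insert j S)
          * overlap k I w u (\<alpha>(?q := y, ?p := x) \<circ> swap_pairs (insert j J)) (\<beta>(?q := b, ?p := a))
        = chi J S * overlap k' I' (diffw w x y) (diffw u a b) (\<alpha> \<circ> swap_pairs J) \<beta>"
        unfolding c1 k(1) D[symmetric] right_diff_distrib by (simp only: mult_minus_left diff_conv_add_uminus)
    qed
    then show ?thesis by simp
  qed
  have IH: "c * (Wvec k' (V - {x, y}) (diffw w x y) ?i * Wvec k' (U - {a, b}) (diffw u a b) ?i)
      \<le> (\<Sum>\<alpha>\<in>bijs I' (V - {x, y}). \<Sum>\<beta>\<in>bijs I' (U - {a, b}).
          \<bar>\<Sum>J\<in>Pow K'. chi J S
            * overlap k' I' (diffw w x y) (diffw u a b) (\<alpha> \<circ> swap_pairs J) \<beta>\<bar>)"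
    if "(x, y) \<in> distinct_pairs V" "(a, b) \<in> distinct_pairs U" for x y a b
    unfolding c_def
  proof (rule insert.IH)
    show "card I' = card (V - {x, y})" "card I' = card (U - {a, b})"
      using that insert.prems by (auto simp: cI' n_def distinct_pairs_def card_Diff_subset)
  qed (use insert.prems pairsK' SK' k cI' K in auto)
  define WS where "WS = (\<Sum>(x, y)\<in>distinct_pairs V. Wvec k' (V - {x, y}) (diffw w x y) ?i)"
  define US where "US = (\<Sum>(x, y)\<in>distinct_pairs U. Wvec k' (U - {x, y}) (diffw u x y) ?i)"
  have n0: "real n * (real n - 1) > 0" using n2 by simp
  have W: "WS = real n * (real n - 1) * Wvec k V w (Suc ?i)"
    "US = real n * (real n - 1) * Wvec k U u (Suc ?i)"
    using n0 insert.prems unfolding WS_def US_def distinct_pairs_def k n_def by auto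
  \<comment> \<open>The factor n (n - 1) is the denominator in the recursion of the W-vector, once
    for each of the two hypergraphs.\<close>
  have fact: "fact n = real n * (real n - 1) * (fact (n - 2) :: real)"
    using n2 by (cases n; cases "n - 1") (auto simp: algebra_simps)
  have "card (insert j S) = Suc ?i" using insert.hyps by simp
  then have "2 ^ (card K - card (insert j S)) * real ((card I - 2 * card (insert j S)) choose (k - card (insert j S)))
      * (fact (card I))\<^sup>2 * (Wvec k V w (card (insert j S)) * Wvec k U u (card (insert j S)))
    = c * (WS * US)"
    using K unfolding W c_def cI' n_def[symmetric] fact k(1) by (simp add: power2_eq_square mult_ac)
  also have "\<dots> = (\<Sum>(x, y)\<in>distinct_pairs V. \<Sum>(a, b)\<in>distinct_pairs U.
      c * (Wvec k' (V - {x, y}) (diffw w x y) ?i * Wvec k' (U - {a, b}) (diffw u a b) ?i))"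
    unfolding WS_def US_def
    by (simp only: split_def sum_product) (simp only: sum_distrib_left)
  also have "\<dots> \<le> (\<Sum>(x, y)\<in>distinct_pairs V. \<Sum>(a, b)\<in>distinct_pairs U.
      \<Sum>\<alpha>\<in>bijs I' (V - {x, y}). \<Sum>\<beta>\<in>bijs I' (U - {a, b}).
          \<bar>\<Sum>J\<in>Pow K'. chi J S
            * overlap k' I' (diffw w x y) (diffw u a b) (\<alpha> \<circ> swap_pairs J) \<beta>\<bar>)"
    using IH by (auto intro!: sum_mono)
  also have "\<dots> = (\<Sum>(x, y)\<in>distinct_pairs V. \<Sum>\<alpha>\<in>bijs I' (V - {x, y}).
      \<Sum>(a, b)\<in>distinct_pairs U. \<Sum>\<beta>\<in>bijs I' (U - {a, b}).
          \<bar>\<Sum>J\<in>Pow K'. chi J S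
            * overlap k' I' (diffw w x y) (diffw u a b) (\<alpha> \<circ> swap_pairs J) \<beta>\<bar>)"
    unfolding split_def by (intro sum.cong refl sum.swap)
  also have "\<dots> = (\<Sum>\<alpha>\<in>bijs I V. \<Sum>\<beta>\<in>bijs I U.
      \<bar>\<Sum>J\<in>Pow K. chi J (insert j S) * overlap k I w u (\<alpha> \<circ> swap_pairs J) \<beta>\<bar>)"
  proof -
    have pq': "?p \<in> I" "?q \<in> I" "?p \<noteq> ?q" using pq by auto
    show ?thesis
      by (simp only: sum_bijs_remove_pair[OF insert.prems(1,2) pq']
          sum_bijs_remove_pair[OF insert.prems(1,3) pq'] I'_def[symmetric] step)
  qed
  finally show ?case .
qed

section \<open>Slopes of bounded polynomials\<close>

text \<open>The induction passes from G(p) to G(p) - 2^(k+1) G(p/2), which has no term of degree k + 1.\<close>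

lemma poly_coeff_bound:
  "\<exists>C>0. \<forall>(A :: nat \<Rightarrow> real) B. (\<forall>p\<in>{0..1}. \<bar>\<Sum>r\<le>k. A r * p ^ r\<bar> \<le> B) \<longrightarrow> (\<forall>r\<le>k. \<bar>A r\<bar> \<le> C * B)"
proof (induction k)
  case 0
  show ?case by (rule exI[of _ 1]) auto
next
  case (Suc k)
  then obtain C where C: "C > 0"
    and bound: "\<And>A B r. (\<forall>p\<in>{0..1}. \<bar>\<Sum>r\<le>k. A r * p ^ r\<bar> \<le> B) \<Longrightarrow> r \<le> k \<Longrightarrow> \<bar>A r\<bar> \<le> C * (B :: real)"
    by blast
  define D where "D = C * (1 + 2 ^ Suc k)"
  have D: "D > 0" using C by (simp add: D_def add_pos_pos)
  have "\<bar>A r\<bar> \<le> (1 + real (Suc k) * D + D) * B"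
    if A: "\<forall>p\<in>{0..1}. \<bar>\<Sum>r\<le>Suc k. A r * p ^ r\<bar> \<le> B" and r: "r \<le> Suc k" for A B r
  proof -
    define G where "G p = (\<Sum>r\<le>Suc k. A r * p ^ r)" for p :: real
    have G: "\<bar>G p\<bar> \<le> B" if "p \<in> {0..1}" for p using A that by (simp add: G_def)
    have B: "B \<ge> 0" using G[of 0] by force
    have low: "\<bar>A r\<bar> \<le> D * B" if r: "r \<le> k" for r
    proof -
      \<comment> \<open>The multiplier of \<open>A r\<close> vanishes for r = k + 1, which lowers
        the degree, and has absolute value at least 1 for r \<le> k, so a bound on the new
        coefficient passes to \<open>A r\<close>.\<close>
      have "\<bar>A r * (1 - 2 ^ (Suc k - r))\<bar> \<le> C * ((1 + 2 ^ Suc k) * B)"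
      proof (rule bound[OF _ r], intro ballI)
        fix p :: real assume p: "p \<in> {0..1}"
        have "(\<Sum>r\<le>k. A r * (1 - 2 ^ (Suc k - r)) * p ^ r)
            = (\<Sum>r\<le>Suc k. A r * (1 - 2 ^ (Suc k - r)) * p ^ r)" by simp
        also have "\<dots> = (\<Sum>r\<le>Suc k. A r * p ^ r - 2 ^ Suc k * (A r * (p / 2) ^ r))"
        proof (rule sum.cong[OF refl])
          fix r assume "r \<in> {..Suc k}"
          then have "(2::real) ^ Suc k = 2 ^ (Suc k - r) * 2 ^ r"
            by (simp flip: power_add)
          then show "A r * (1 - 2 ^ (Suc k - r)) * p ^ r = A r * p ^ r - 2 ^ Suc k * (A r * (p / 2) ^ r)"
            by (simp add: power_divide algebra_simps del: power_Suc)
        qed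
        also have "\<dots> = G p - 2 ^ Suc k * G (p / 2)"
          by (simp only: G_def sum_subtractf sum_distrib_left)
        also have "\<bar>\<dots>\<bar> \<le> \<bar>G p\<bar> + 2 ^ Suc k * \<bar>G (p / 2)\<bar>"
          by (rule order_trans[OF abs_triangle_ineq4]) (simp add: abs_mult)
        also have "\<dots> \<le> B + 2 ^ Suc k * B"
          using p by (intro add_mono mult_left_mono G) auto
        finally show "\<bar>\<Sum>r\<le>k. A r * (1 - 2 ^ (Suc k - r)) * p ^ r\<bar> \<le> (1 + 2 ^ Suc k) * B"
          by (simp add: algebra_simps)
      qed
      moreover have "\<bar>A r\<bar> * 1 \<le> \<bar>A r\<bar> * \<bar>1 - 2 ^ (Suc k - r)\<bar>"
      proof (rule mult_left_mono)
        have "(2::real) ^ 1 \<le> 2 ^ (Suc k - r)" using r by (intro power_increasing) auto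
        then show "(1::real) \<le> \<bar>1 - 2 ^ (Suc k - r)\<bar>" by simp
      qed simp
      ultimately show ?thesis by (simp add: abs_mult D_def mult_ac)
    qed
    show ?thesis
    proof (cases "r \<le> k")
      case True
      then show ?thesis
        using low[OF True] D B by (auto simp: algebra_simps intro: order_trans)
    next
      case False
      then have "r = Suc k" using r by simp
      \<comment> \<open>The top coefficient is recovered from the value at 1 and the lower
        coefficients.\<close>
      then have "A r = G 1 - (\<Sum>r\<le>k. A r)" by (simp add: G_def)
      also have "\<bar>\<dots>\<bar> \<le> \<bar>G 1\<bar> + (\<Sum>r\<le>k. \<bar>A r\<bar>)"
        using abs_triangle_ineq4[of "G 1" "\<Sum>r\<le>k. A r"] sum_abs[of A "{..k}"] by linarith
      also have "\<dots> \<le> B + (\<Sum>r\<le>k. D * B)"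
        using low by (intro add_mono G sum_mono) auto
      also have "\<dots> \<le> (1 + real (Suc k) * D + D) * B"
        using D B by (simp add: algebra_simps)
      finally show ?thesis .
    qed
  qed
  moreover have "1 + real (Suc k) * D + D > 0" using D by (simp add: add_pos_pos)
  ultimately show ?case by blast
qed

text \<open>A polynomial on [-1, 1] that vanishes at 0 and has slope L there but stays above -m needs a
  second-order part of size about L^2 / m to recover, and its coefficients are bounded by its maximum.\<close>

lemma linear_coeff_le:
  fixes k :: nat
  assumes "k \<ge> 1"
  shows "\<exists>D>0. \<forall>(A :: nat \<Rightarrow> real) m M. A 0 = 0 \<longrightarrow>
    (\<forall>p\<in>{-1..1}. - m \<le> (\<Sum>r\<le>k. A r * p ^ r) \<and> (\<Sum>r\<le>k. A r * p ^ r) \<le> M) \<longrightarrow> (A 1)\<^sup>2 \<le> D * (M * m)"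
proof -
  obtain C where C: "C > 0"
    and bound: "\<And>A B r. (\<forall>p\<in>{0..1}. \<bar>\<Sum>r\<le>k. A r * p ^ r\<bar> \<le> B) \<Longrightarrow> r \<le> k \<Longrightarrow> \<bar>A r\<bar> \<le> C * (B :: real)"
    using poly_coeff_bound[of k] by blast
  define D where "D = real k * C"
  have D: "D > 0" "D \<ge> C" using C assms by (auto simp: D_def)
  \<comment> \<open>Replacing \<open>A\<close> by its negative exchanges \<open>m\<close> and
    \<open>M\<close>, so the case m \<le> M suffices. There \<open>M\<close> bounds the absolute
    value of the polynomial and hence its coefficients.\<close>
  have main: "(A 1)\<^sup>2 \<le> 4 * D * (M * m)"
    if A0: "A 0 = 0" and mM: "m \<le> M"
      and G: "\<And>p. p \<in> {-1..1} \<Longrightarrow> - m \<le> (\<Sum>r\<le>k. A r * p ^ r) \<and> (\<Sum>r\<le>k. A r * p ^ r) \<le> M"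
    for A :: "nat \<Rightarrow> real" and m M
  proof -
    have "(\<Sum>r\<le>k. A r * 0 ^ r) = 0" using A0 by (simp add: sum.atMost_shift)
    then have m0: "m \<ge> 0" using G[of 0] by auto
    have coef: "\<bar>A r\<bar> \<le> C * M" if "r \<le> k" for r
    proof (rule bound[OF _ that], intro ballI)
      fix p :: real assume "p \<in> {0..1}"
      then show "\<bar>\<Sum>r\<le>k. A r * p ^ r\<bar> \<le> M" using G[of p] mM by auto
    qed
    define L where "L = \<bar>A 1\<bar>"
    show ?thesis
    proof (cases "M = 0")
      case True
      then show ?thesis using coef[of 1] assms by simp
    next
      case False
      then have M: "M > 0" using m0 mM by simp
      \<comment> \<open>Moving distance \<open>t\<close> against the slope gives a value of at most
        - L t + D M t^2, since fewer than \<open>k\<close> further terms are each at most C M t^2.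
        This \<open>t\<close> minimises that bound, at - L^2 / (4 D M); L \<le> C M keeps it in
        [0, 1].\<close>
      define t where "t = L / (2 * D * M)"
      have t0: "t \<ge> 0" using D M by (simp add: t_def L_def)
      have "L \<le> C * M" using coef[of 1] assms by (simp add: L_def)
      also have "\<dots> \<le> 2 * D * M" using D M C by (intro mult_right_mono) auto
      finally have t1: "t \<le> 1" using D M by (simp add: t_def)
      define p where "p = (if A 1 \<ge> 0 then - t else t)"
      have p: "p \<in> {-1..1}" "A 1 * p = - (L * t)" "\<bar>p\<bar> = t"
        using t0 t1 by (auto simp: p_def L_def)
      have "(\<Sum>r\<le>k. A r * p ^ r) = A 1 * p + (\<Sum>r\<in>{..k} - {0, 1}. A r * p ^ r)"
        using assms A0 by (subst sum.subset_diff[of "{0, 1}"]) auto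
      also have "(\<Sum>r\<in>{..k} - {0, 1}. A r * p ^ r) \<le> (\<Sum>r\<in>{..k} - {0, 1}. C * M * t\<^sup>2)"
      proof (rule sum_mono)
        fix r assume r: "r \<in> {..k} - {0, 1}"
        have "A r * p ^ r \<le> \<bar>A r\<bar> * \<bar>p\<bar> ^ r" by (metis abs_ge_self abs_mult power_abs)
        also have "\<dots> \<le> (C * M) * t\<^sup>2"
          unfolding p(3) using r t0 t1 C M
          by (intro mult_mono coef power_decreasing) auto
        finally show "A r * p ^ r \<le> C * M * t\<^sup>2" .
      qed
      also have "(\<Sum>r\<in>{..k} - {0, 1}. C * M * t\<^sup>2) \<le> D * M * t\<^sup>2"
      proof -
        have "real (card ({..k} - {0, 1})) \<le> real k" using assms by (simp add: card_Diff_subset)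
        then have "real (card ({..k} - {0, 1})) * (C * M * t\<^sup>2) \<le> real k * (C * M * t\<^sup>2)"
          using C M by (intro mult_right_mono) auto
        then show ?thesis by (simp add: D_def mult_ac)
      qed
      finally have "L * t \<le> m + D * M * t\<^sup>2"
        using G[OF p(1)] p(2) by simp
      moreover have "L * t = L\<^sup>2 / (2 * D * M)" "D * M * t\<^sup>2 = L\<^sup>2 / (4 * D * M)"
        using D M by (simp_all add: t_def power2_eq_square)
      ultimately have "L\<^sup>2 \<le> 4 * D * (M * m)"
        using D M by (simp add: field_simps)
      then show ?thesis by (simp add: L_def)
    qed
  qed
  have "(A 1)\<^sup>2 \<le> 4 * D * (M * m)"
    if A0: "A 0 = 0"
      and G: "\<forall>p\<in>{-1..1}. - m \<le> (\<Sum>r\<le>k. A r * p ^ r) \<and> (\<Sum>r\<le>k. A r * p ^ r) \<le> M"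
    for A :: "nat \<Rightarrow> real" and m M
  proof (cases "m \<le> M")
    case True
    then show ?thesis using main[of A m M] A0 G by blast
  next
    case False
    have "(- A 1)\<^sup>2 \<le> 4 * D * (m * M)"
      using main[of "\<lambda>r. - A r" M m] A0 G False by (force simp: sum_negf)
    then show ?thesis by (simp add: mult_ac)
  qed
  then show ?thesis using D by (intro exI[of _ "4 * D"]) auto
qed

section \<open>Discrepancy and linear coefficients\<close>

text \<open>The cube of P \<union> Q is the product of the cubes of \<open>P\<close> and
  \<open>Q\<close>, and its characters factor accordingly.\<close>

lemma fourier_fourier:
  assumes "finite P" "finite Q" "P \<inter> Q = {}" "S \<subseteq> P" "T \<subseteq> Q"
  shows "fourier Q (\<lambda>J. fourier P (\<lambda>J'. g (J \<union> J')) S) T = fourier (P \<union> Q) g (S \<union> T)"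
proof -
  have "(\<Sum>J\<in>Pow (P \<union> Q). chi J (S \<union> T) * g J)
      = (\<Sum>(J, J')\<in>Pow Q \<times> Pow P. chi J T * (chi J' S * g (J \<union> J')))"
  proof (rule sum.reindex_bij_witness[where j = "\<lambda>J. (J \<inter> Q, J \<inter> P)"
        and i = "\<lambda>(J, J'). J \<union> J'"], goal_cases)
    case (5 J)
    have "chi J (S \<union> T) = chi J S * chi J T"
    proof -
      have "J \<inter> (S \<union> T) = (J \<inter> S) \<union> (J \<inter> T)" by blast
      moreover have "card ((J \<inter> S) \<union> (J \<inter> T)) = card (J \<inter> S) + card (J \<inter> T)"
        using assms by (intro card_Un_disjoint) (auto intro: finite_subset)
      ultimately show ?thesis by (simp add: chi_def power_add)
    qed
    moreover have "J \<inter> Q \<inter> T = J \<inter> T" "J \<inter> P \<inter> S = J \<inter> S" "(J \<inter> Q) \<union> (J \<inter> P) = J"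
      using 5 assms by auto
    ultimately show ?case by (simp add: chi_def)
  qed (use assms in auto)
  also have "\<dots> = (\<Sum>J\<in>Pow Q. chi J T * (\<Sum>J'\<in>Pow P. chi J' S * g (J \<union> J')))"
    by (simp add: sum.cartesian_product[symmetric] sum_distrib_left)
  finally show ?thesis
    using assms
    by (simp add: fourier_def card_Un_disjoint power_add sum_divide_distrib[symmetric])
qed

text \<open>The multilinear extension at a point of the solid cube is the mean of \<open>h\<close>
  under the product measure of \<open>chi_expectation\<close>, hence lies between any bounds on
  \<open>h\<close>.\<close>

lemma multilinear_bounds:
  assumes "finite K" "\<And>j. j \<in> K \<Longrightarrow> \<bar>t j\<bar> \<le> 1" "\<And>J. J \<subseteq> K \<Longrightarrow> lo \<le> h J \<and> h J \<le> hi"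
  shows "lo \<le> (\<Sum>S\<in>Pow K. fourier K h S * (\<Prod>j\<in>S. t j))"
    and "(\<Sum>S\<in>Pow K. fourier K h S * (\<Prod>j\<in>S. t j)) \<le> hi"
proof -
  define p where "p J = (\<Prod>j\<in>J. (1 - t j) / 2) * (\<Prod>j\<in>K - J. (1 + t j) / 2)" for J
  have p0: "p J \<ge> 0" if "J \<in> Pow K" for J
  proof -
    have "0 \<le> (1 - t j) / 2" "0 \<le> (1 + t j) / 2" if "j \<in> K" for j
      using assms(2)[OF that] by auto
    then show ?thesis
      using that unfolding p_def by (intro mult_nonneg_nonneg prod_nonneg; blast)
  qed
  have p1: "(\<Sum>J\<in>Pow K. p J) = 1"
    using chi_expectation[OF assms(1), of "{}" t] by (simp add: p_def)
  have "(\<Sum>S\<in>Pow K. fourier K h S * (\<Prod>j\<in>S. t j))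
      = (\<Sum>S\<in>Pow K. \<Sum>J\<in>Pow K. p J * (fourier K h S * chi J S))"
  proof (rule sum.cong[OF refl])
    fix S assume "S \<in> Pow K"
    then have prod: "(\<Prod>j\<in>S. t j) = (\<Sum>J\<in>Pow K. p J * chi J S)"
      using chi_expectation[OF assms(1), of S t] by (simp add: p_def)
    show "fourier K h S * (\<Prod>j\<in>S. t j) = (\<Sum>J\<in>Pow K. p J * (fourier K h S * chi J S))"
      unfolding prod sum_distrib_left by (intro sum.cong refl) simp
  qed
  also have "\<dots> = (\<Sum>J\<in>Pow K. p J * (\<Sum>S\<in>Pow K. fourier K h S * chi J S))"
    by (subst sum.swap) (simp add: sum_distrib_left)
  also have "\<dots> = (\<Sum>J\<in>Pow K. p J * h J)"
    using fourier_inversion[OF assms(1), of _ h] by simp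
  finally have eq: "(\<Sum>S\<in>Pow K. fourier K h S * (\<Prod>j\<in>S. t j)) = (\<Sum>J\<in>Pow K. p J * h J)" .
  have "lo = (\<Sum>J\<in>Pow K. p J * lo)" using p1 by (simp flip: sum_distrib_right)
  also have "\<dots> \<le> (\<Sum>J\<in>Pow K. p J * h J)"
    using p0 assms(3) by (intro sum_mono mult_left_mono) auto
  finally show "lo \<le> (\<Sum>S\<in>Pow K. fourier K h S * (\<Prod>j\<in>S. t j))" by (simp add: eq)
  have "(\<Sum>J\<in>Pow K. p J * h J) \<le> (\<Sum>J\<in>Pow K. p J * hi)"
    using p0 assms(3) by (intro sum_mono mult_left_mono) auto
  also have "\<dots> = hi" using p1 by (simp flip: sum_distrib_right)
  finally show "(\<Sum>S\<in>Pow K. fourier K h S * (\<Prod>j\<in>S. t j)) \<le> hi" by (simp add: eq)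
qed

text \<open>An edge with \<open>k\<close> indices meets at most \<open>k\<close> pairs, so it misses
  some pair of \<open>S\<close>. Swapping that pair leaves the image of the edge alone but flips the
  character, and the terms cancel.\<close>

lemma fourier_overlap_eq_0:
  assumes K: "finite K" "S \<subseteq> K" and I: "finite I" and k: "k < card S"
  shows "fourier K (\<lambda>J. overlap k I w u (\<alpha> \<circ> swap_pairs J) \<beta>) S = 0"
proof -
  have zero: "(\<Sum>J\<in>Pow K. chi J S * w ((\<alpha> \<circ> swap_pairs J) ` e)) = 0" if e: "e \<in> ksub I k" for e
  proof -
    have fe: "finite e" "card e = k" using e I by (auto simp: ksub_def intro: finite_subset)
    have "\<not> S \<subseteq> (\<lambda>i. i div 2) ` e"
      using card_mono[of "(\<lambda>i. i div 2) ` e" S] card_image_le[OF fe(1), of "\<lambda>i. i div 2"] fe k by auto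
    then obtain j where j: "j \<in> S" "\<And>i. i \<in> e \<Longrightarrow> i div 2 \<noteq> j" by blast
    define K' where "K' = K - {j}"
    have K': "K = insert j K'" "j \<notin> K'" "finite K'" using j K by (auto simp: K'_def)
    have "chi J S * w ((\<alpha> \<circ> swap_pairs J) ` e)
        + chi (insert j J) S * w ((\<alpha> \<circ> swap_pairs (insert j J)) ` e) = 0" if "J \<in> Pow K'" for J
    proof -
      have J: "finite J" "j \<notin> J" using that K' finite_subset by auto
      have "(\<alpha> \<circ> swap_pairs (insert j J)) ` e = (\<alpha> \<circ> swap_pairs J) ` e"
        using j(2) by (intro image_cong refl) (auto simp: swap_pairs_def)
      then show ?thesis
        using chi_insert_left[OF J, of S] j(1) by simp
    qed
    then show ?thesis
      unfolding K'(1) sum_Pow_insert[OF K'(3,2)] by (intro sum.neutral) blast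
  qed
  have "(\<Sum>J\<in>Pow K. chi J S * overlap k I w u (\<alpha> \<circ> swap_pairs J) \<beta>)
      = (\<Sum>J\<in>Pow K. \<Sum>e\<in>ksub I k. u (\<beta> ` e) * (chi J S * w ((\<alpha> \<circ> swap_pairs J) ` e)))"
    by (simp only: overlap_def sum_distrib_left mult_ac)
  also have "\<dots> = (\<Sum>e\<in>ksub I k. u (\<beta> ` e) * (\<Sum>J\<in>Pow K. chi J S * w ((\<alpha> \<circ> swap_pairs J) ` e)))"
    by (subst sum.swap) (simp only: sum_distrib_left)
  also have "\<dots> = 0" using zero by simp
  finally show ?thesis by (simp add: fourier_def)
qed

lemma overlap_disc_bounds:
  fixes k :: nat and V :: "'a set" and w u :: "'a set \<Rightarrow> real"
  assumes V: "finite V" and \<alpha>: "\<alpha> \<in> bijs I V" and \<beta>: "\<beta> \<in> bijs I V"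
  defines "\<mu> \<equiv> dens V k w * dens V k u * real (card V choose k)"
  shows "\<mu> - disc_minus V k w u \<le> overlap k I w u \<alpha> \<beta>"
    and "overlap k I w u \<alpha> \<beta> \<le> \<mu> + disc_plus V k w u"
proof -
  have a: "bij_betw \<alpha> I V" and b: "bij_betw \<beta> I V" using \<alpha> \<beta> by (auto simp: bijs_def)
  \<comment> \<open>This is \<beta> composed with the inverse of \<alpha>, extended by the identity;
    its \<open>permip\<close> is the overlap.\<close>
  define \<pi> where "\<pi> v = (if v \<in> V then \<beta> (inv_into I \<alpha> v) else v)" for v
  have "bij_betw (\<beta> \<circ> inv_into I \<alpha>) V V"
    by (rule bij_betw_trans[OF bij_betw_inv_into[OF a] b])
  then have "bij_betw \<pi> V V"
    by (subst bij_betw_cong[where g = "\<beta> \<circ> inv_into I \<alpha>"]) (auto simp: \<pi>_def)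
  then have perm: "\<pi> permutes V"
    by (rule bij_imp_permutes) (auto simp: \<pi>_def)
  have inv: "inv \<pi> (\<beta> i) = \<alpha> i" if "i \<in> I" for i
  proof -
    have "\<pi> (\<alpha> i) = \<beta> i"
      using that a by (auto simp: \<pi>_def bij_betw_def)
    then show ?thesis using permutes_inv_eq[OF perm] by blast
  qed
  have "permip V k \<pi> w u = (\<Sum>e\<in>ksub I k. w (inv \<pi> ` \<beta> ` e) * u (\<beta> ` e))"
    unfolding permip_def
    by (rule sum.reindex_bij_betw[OF ksub_image_bij[OF b], symmetric])
  also have "\<dots> = overlap k I w u \<alpha> \<beta>"
    unfolding overlap_def
  proof (intro sum.cong refl)
    fix e assume "e \<in> ksub I k"
    then have "inv \<pi> ` \<beta> ` e = \<alpha> ` e"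
      unfolding image_comp using inv by (intro image_cong) (auto simp: ksub_def)
    then show "w (inv \<pi> ` \<beta> ` e) * u (\<beta> ` e) = w (\<alpha> ` e) * u (\<beta> ` e)" by simp
  qed
  finally have "overlap k I w u \<alpha> \<beta> \<in> {permip V k \<pi> w u | \<pi>. \<pi> permutes V}"
    using perm by force
  moreover have "finite {permip V k \<pi> w u | \<pi>. \<pi> permutes V}"
    using finite_permutations[OF V] by simp
  ultimately show "\<mu> - disc_minus V k w u \<le> overlap k I w u \<alpha> \<beta>"
    "overlap k I w u \<alpha> \<beta> \<le> \<mu> + disc_plus V k w u"
    by (auto simp: disc_minus_def disc_plus_def \<mu>_def)
qed

text \<open>Swap pair j with probability (1 - p s) / 2, independently, where s is the sign of the j-th linear
  coefficient. The mean overlap is a polynomial in p whose linear coefficient is the sum on the left.\<close>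

lemma disc_product_ge_linear:
  assumes D: "\<forall>(A :: nat \<Rightarrow> real) m M. A 0 = 0 \<longrightarrow>
      (\<forall>p\<in>{-1..1}. - m \<le> (\<Sum>r\<le>k. A r * p ^ r) \<and> (\<Sum>r\<le>k. A r * p ^ r) \<le> M) \<longrightarrow>
      (A 1)\<^sup>2 \<le> D * (M * m)"
    and fin: "finite I" "finite V" "card I = card V"
    and P: "finite P" "\<And>j. j \<in> P \<Longrightarrow> {2 * j, 2 * j + 1} \<subseteq> I"
  shows "((\<Sum>\<alpha>\<in>bijs I V. \<Sum>\<beta>\<in>bijs I V. \<Sum>j\<in>P.
        \<bar>fourier P (\<lambda>J. overlap k I w u (\<alpha> \<circ> swap_pairs J) \<beta>) {j}\<bar>) / (fact (card V))\<^sup>2)\<^sup>2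
    \<le> D * (disc_plus V k w u * disc_minus V k w u)"
proof -
  define F where "F = (fact (card V) :: real)\<^sup>2"
  have F: "F > 0" by (simp add: F_def)
  define \<mu> where "\<mu> = dens V k w * dens V k u * real (card V choose k)"
  define a where "a \<alpha> \<beta> = fourier P (\<lambda>J. overlap k I w u (\<alpha> \<circ> swap_pairs J) \<beta>)" for \<alpha> \<beta>
  define \<sigma> where "\<sigma> \<alpha> \<beta> j = (if a \<alpha> \<beta> {j} \<ge> 0 then 1 else -1 :: real)" for \<alpha> \<beta> j
  define B where "B r = (\<Sum>\<alpha>\<in>bijs I V. \<Sum>\<beta>\<in>bijs I V.
      \<Sum>S\<in>{S \<in> Pow P. card S = r}. a \<alpha> \<beta> S * (\<Prod>j\<in>S. \<sigma> \<alpha> \<beta> j))" for r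
  \<comment> \<open>Subtracting the mean \<mu> removes the constant term and turns the bounds on the
    overlap into \<open>- disc_minus\<close> and \<open>disc_plus\<close>.\<close>
  define A where "A r = B r / F - (if r = 0 then \<mu> else 0)" for r
  have perm: "swap_pairs J permutes I" if "J \<subseteq> P" for J
    using that P(2) by (intro swap_pairs_permutes) blast
  have avg: "(\<Sum>\<alpha>\<in>bijs I V. \<Sum>\<beta>\<in>bijs I V. c) = F * c" for c :: real
    using card_bijs[OF fin] by (simp add: F_def power2_eq_square)
  have A0: "A 0 = 0"
  proof -
    have "{S \<in> Pow P. card S = 0} = {{}}" using P(1) by (auto dest: finite_subset)
    then have "B 0 = (\<Sum>\<alpha>\<in>bijs I V. \<Sum>\<beta>\<in>bijs I V. a \<alpha> \<beta> {})" by (simp add: B_def)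
    also have "\<dots> = (\<Sum>\<alpha>\<in>bijs I V. \<Sum>\<beta>\<in>bijs I V. \<Sum>J\<in>Pow P.
        overlap k I w u (\<alpha> \<circ> swap_pairs J) \<beta>) / 2 ^ card P"
      by (simp add: a_def fourier_def sum_divide_distrib)
    also have "\<dots> = F * \<mu>"
      using sum_overlap_swaps[OF fin(1,2,2,3,3) P] fin by (simp add: F_def \<mu>_def)
    finally show ?thesis using F by (simp add: A_def)
  qed
  have A1: "A 1 = (\<Sum>\<alpha>\<in>bijs I V. \<Sum>\<beta>\<in>bijs I V. \<Sum>j\<in>P. \<bar>a \<alpha> \<beta> {j}\<bar>) / F"
  proof -
    have "{S \<in> Pow P. card S = 1} = (\<lambda>j. {j}) ` P" by (auto simp: card_1_singleton_iff)
    then have "B 1 = (\<Sum>\<alpha>\<in>bijs I V. \<Sum>\<beta>\<in>bijs I V. \<Sum>j\<in>P. a \<alpha> \<beta> {j} * \<sigma> \<alpha> \<beta> j)"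
      by (simp add: B_def sum.reindex)
    also have "\<dots> = (\<Sum>\<alpha>\<in>bijs I V. \<Sum>\<beta>\<in>bijs I V. \<Sum>j\<in>P. \<bar>a \<alpha> \<beta> {j}\<bar>)"
      by (intro sum.cong refl) (simp add: \<sigma>_def)
    finally show ?thesis by (simp add: A_def)
  qed
  have "- disc_minus V k w u \<le> (\<Sum>r\<le>k. A r * p ^ r) \<and> (\<Sum>r\<le>k. A r * p ^ r) \<le> disc_plus V k w u"
    if p: "p \<in> {-1..1}" for p
  proof -
    define g where "g \<alpha> \<beta> = (\<Sum>S\<in>Pow P. a \<alpha> \<beta> S * (\<Prod>j\<in>S. p * \<sigma> \<alpha> \<beta> j))" for \<alpha> \<beta>
    have g: "\<mu> - disc_minus V k w u \<le> g \<alpha> \<beta>" "g \<alpha> \<beta> \<le> \<mu> + disc_plus V k w u"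
      if ab: "\<alpha> \<in> bijs I V" "\<beta> \<in> bijs I V" for \<alpha> \<beta>
    proof -
      have bnd: "\<mu> - disc_minus V k w u \<le> overlap k I w u (\<alpha> \<circ> swap_pairs J) \<beta>
          \<and> overlap k I w u (\<alpha> \<circ> swap_pairs J) \<beta> \<le> \<mu> + disc_plus V k w u" if "J \<subseteq> P" for J
        using overlap_disc_bounds[OF fin(2) bijs_comp[OF ab(1) perm[OF that]] ab(2)]
        unfolding \<mu>_def by blast
      have t: "\<bar>p * \<sigma> \<alpha> \<beta> j\<bar> \<le> 1" for j using p by (auto simp: \<sigma>_def)
      show "\<mu> - disc_minus V k w u \<le> g \<alpha> \<beta>" "g \<alpha> \<beta> \<le> \<mu> + disc_plus V k w u"
        unfolding g_def a_def
        by (rule multilinear_bounds[OF P(1)]; use t bnd in blast)+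
    qed
    have group: "g \<alpha> \<beta> = (\<Sum>r\<le>k. (\<Sum>S\<in>{S \<in> Pow P. card S = r}. a \<alpha> \<beta> S * (\<Prod>j\<in>S. \<sigma> \<alpha> \<beta> j)) * p ^ r)"
      for \<alpha> \<beta>
    proof -
      let ?X = "{S \<in> Pow P. card S \<le> k}"
      \<comment> \<open>Levels above \<open>k\<close> vanish, which caps the degree in
        \<open>p\<close> at \<open>k\<close>.\<close>
      have "g \<alpha> \<beta> = (\<Sum>S\<in>?X. a \<alpha> \<beta> S * (\<Prod>j\<in>S. p * \<sigma> \<alpha> \<beta> j))"
        unfolding g_def
        by (rule sum.mono_neutral_right)
          (use P(1) fin(1) in \<open>auto simp: a_def intro!: fourier_overlap_eq_0\<close>)
      also have "\<dots> = (\<Sum>r\<le>k. \<Sum>S\<in>{S \<in> ?X. card S = r}. a \<alpha> \<beta> S * (\<Prod>j\<in>S. p * \<sigma> \<alpha> \<beta> j))"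
        using P(1) by (intro sum.group[symmetric]) auto
      also have "\<dots> = (\<Sum>r\<le>k. (\<Sum>S\<in>{S \<in> Pow P. card S = r}. a \<alpha> \<beta> S * (\<Prod>j\<in>S. \<sigma> \<alpha> \<beta> j)) * p ^ r)"
        unfolding sum_distrib_right
        by (intro sum.cong refl) (auto simp: prod.distrib)
      finally show ?thesis .
    qed
    have "(\<Sum>r\<le>k. A r * p ^ r) = (\<Sum>r\<le>k. B r * p ^ r) / F - \<mu>"
    proof -
      have "(\<Sum>r\<le>k. A r * p ^ r) = (\<Sum>r\<le>k. B r * p ^ r / F - (if r = 0 then \<mu> else 0))"
        by (intro sum.cong refl) (auto simp: A_def left_diff_distrib)
      then show ?thesis by (simp add: sum_subtractf sum_divide_distrib)
    qed
    also have "(\<Sum>r\<le>k. B r * p ^ r) = (\<Sum>\<alpha>\<in>bijs I V. \<Sum>\<beta>\<in>bijs I V. g \<alpha> \<beta>)"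
      unfolding B_def group sum_distrib_right
      by (simp only: sum.swap[of _ "bijs I V" "{..k}"])
    finally have G: "(\<Sum>r\<le>k. A r * p ^ r) = (\<Sum>\<alpha>\<in>bijs I V. \<Sum>\<beta>\<in>bijs I V. g \<alpha> \<beta>) / F - \<mu>" .
    have "F * (\<mu> - disc_minus V k w u) \<le> (\<Sum>\<alpha>\<in>bijs I V. \<Sum>\<beta>\<in>bijs I V. g \<alpha> \<beta>)"
      "(\<Sum>\<alpha>\<in>bijs I V. \<Sum>\<beta>\<in>bijs I V. g \<alpha> \<beta>) \<le> F * (\<mu> + disc_plus V k w u)"
      unfolding avg[symmetric] using g by (intro sum_mono; blast)+
    then show ?thesis
      unfolding G using F by (simp add: field_simps)
  qed
  then have "(A 1)\<^sup>2 \<le> D * (disc_plus V k w u * disc_minus V k w u)"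
    using D[THEN spec, of A] A0 by blast
  then show ?thesis
    unfolding A1 a_def F_def .
qed

text \<open>As a function of the swaps of the pairs in Q the linear coefficient of pair j has low degree and
  Fourier coefficients of level r + 1 of the overlap, so its mean absolute value is controlled from
  below by their l2 norm.\<close>

lemma sum_linear_coeff_ge:
  fixes w :: "'a set \<Rightarrow> real" and u :: "'b set \<Rightarrow> real"
  assumes fin: "finite I" "finite V" "finite U" "card I = card V" "card I = card U"
    and P: "finite P" "finite Q" "P \<inter> Q = {}" "j \<in> P"
    and pairs: "\<And>j. j \<in> P \<union> Q \<Longrightarrow> {2 * j, 2 * j + 1} \<subseteq> I"
    and r: "Suc r \<le> k"
  shows "sqrt (card Q choose r) * real ((card I - 2 * Suc r) choose (k - Suc r)) * (fact (card I))\<^sup>2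
      * (Wvec k V w (Suc r) * Wvec k U u (Suc r))
    \<le> 3 ^ Suc k * 2 ^ k * (\<Sum>\<alpha>\<in>bijs I V. \<Sum>\<beta>\<in>bijs I U.
        \<bar>fourier P (\<lambda>J. overlap k I w u (\<alpha> \<circ> swap_pairs J) \<beta>) {j}\<bar>)"
proof -
  define c where "c \<alpha> \<beta> = fourier P (\<lambda>J. overlap k I w u (\<alpha> \<circ> swap_pairs J) \<beta>) {j}" for \<alpha> \<beta>
  define b where "b \<alpha> \<beta> = fourier Q (\<lambda>J. c (\<alpha> \<circ> swap_pairs J) \<beta>)" for \<alpha> \<beta>
  define N where "N = real (card Q choose r)"
  define X where "X = real ((card I - 2 * Suc r) choose (k - Suc r)) * (fact (card I))\<^sup>2
      * (Wvec k V w (Suc r) * Wvec k U u (Suc r))"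
  define Z where "Z = (\<Sum>\<alpha>\<in>bijs I V. \<Sum>\<beta>\<in>bijs I U. \<bar>c \<alpha> \<beta>\<bar>)"
  have Z0: "Z \<ge> 0" by (simp add: Z_def sum_nonneg)
  have b: "b \<alpha> \<beta> T = fourier (P \<union> Q) (\<lambda>J. overlap k I w u (\<alpha> \<circ> swap_pairs J) \<beta>) (insert j T)"
    if "T \<subseteq> Q" for \<alpha> \<beta> T
  proof -
    have "b \<alpha> \<beta> T = fourier Q (\<lambda>J. fourier P (\<lambda>J'. overlap k I w u (\<alpha> \<circ> swap_pairs (J \<union> J')) \<beta>) {j}) T"
      unfolding b_def c_def fourier_def
    proof (intro arg_cong2[where f = "(/)"] sum.cong refl arg_cong2[where f = "(*)"])
      fix J J' assume "J \<in> Pow Q" "J' \<in> Pow P"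
      then have "J \<inter> J' = {}" using P(3) by auto
      then show "overlap k I w u (\<alpha> \<circ> swap_pairs J \<circ> swap_pairs J') \<beta>
          = overlap k I w u (\<alpha> \<circ> swap_pairs (J \<union> J')) \<beta>"
        by (simp only: comp_assoc swap_pairs_Un)
    qed
    also have "\<dots> = fourier (P \<union> Q) (\<lambda>J. overlap k I w u (\<alpha> \<circ> swap_pairs J) \<beta>) ({j} \<union> T)"
      using P that by (intro fourier_fourier) auto
    finally show ?thesis by simp
  qed
  have jT: "card (insert j T) = Suc (card T)" if "T \<subseteq> Q" for T
    using that P finite_subset[OF that P(2)] by (intro card_insert_disjoint) auto
  \<comment> \<open>The low-degree L1 bound yields the l2 norm of all coefficients; Cauchy-Schwarz
    over the \<open>N\<close> sets of size \<open>r\<close> passes to their l1 norm at the cost of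
    \<open>sqrt N\<close>.\<close>
  have khin: "2 ^ card Q * (\<Sum>T\<in>ksub Q r. \<bar>b \<alpha> \<beta> T\<bar>)
      \<le> 3 ^ Suc k * sqrt N * (\<Sum>J\<in>Pow Q. \<bar>c (\<alpha> \<circ> swap_pairs J) \<beta>\<bar>)" for \<alpha> \<beta>
  proof -
    have "2 ^ card Q * sqrt (\<Sum>T\<in>Pow Q. (b \<alpha> \<beta> T)\<^sup>2)
        \<le> 3 ^ Suc k * (\<Sum>J\<in>Pow Q. \<bar>\<Sum>T\<in>Pow Q. b \<alpha> \<beta> T * chi J T\<bar>)"
    proof (rule khinchine_low_degree[OF P(2)])
      fix T assume T: "T \<subseteq> Q" "k < card T"
      then show "b \<alpha> \<beta> T = 0"
        using P fin jT[OF T(1)] by (subst b) (auto intro!: fourier_overlap_eq_0)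
    qed
    also have "(\<Sum>J\<in>Pow Q. \<bar>\<Sum>T\<in>Pow Q. b \<alpha> \<beta> T * chi J T\<bar>)
        = (\<Sum>J\<in>Pow Q. \<bar>c (\<alpha> \<circ> swap_pairs J) \<beta>\<bar>)"
      using fourier_inversion[OF P(2), of _ "\<lambda>J. c (\<alpha> \<circ> swap_pairs J) \<beta>"]
      unfolding b_def by (intro sum.cong refl) simp
    finally have low: "2 ^ card Q * sqrt (\<Sum>T\<in>Pow Q. (b \<alpha> \<beta> T)\<^sup>2)
        \<le> 3 ^ Suc k * (\<Sum>J\<in>Pow Q. \<bar>c (\<alpha> \<circ> swap_pairs J) \<beta>\<bar>)" .
    have "(\<Sum>T\<in>ksub Q r. 1 * \<bar>b \<alpha> \<beta> T\<bar>)\<^sup>2 \<le> (\<Sum>T\<in>ksub Q r. 1\<^sup>2) * (\<Sum>T\<in>ksub Q r. \<bar>b \<alpha> \<beta> T\<bar>\<^sup>2)"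
      by (rule Cauchy_Schwarz_ineq_sum)
    also have "\<dots> \<le> N * (\<Sum>T\<in>Pow Q. (b \<alpha> \<beta> T)\<^sup>2)"
    proof -
      have "(\<Sum>T\<in>ksub Q r. (b \<alpha> \<beta> T)\<^sup>2) \<le> (\<Sum>T\<in>Pow Q. (b \<alpha> \<beta> T)\<^sup>2)"
        using P(2) by (intro sum_mono2) (auto simp: ksub_def)
      then show ?thesis
        using P(2) by (simp add: N_def card_ksub mult_left_mono)
    qed
    finally have "(\<Sum>T\<in>ksub Q r. \<bar>b \<alpha> \<beta> T\<bar>) \<le> sqrt (N * (\<Sum>T\<in>Pow Q. (b \<alpha> \<beta> T)\<^sup>2))"
      by (intro real_le_rsqrt) simp
    then have "2 ^ card Q * (\<Sum>T\<in>ksub Q r. \<bar>b \<alpha> \<beta> T\<bar>)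
        \<le> sqrt N * (2 ^ card Q * sqrt (\<Sum>T\<in>Pow Q. (b \<alpha> \<beta> T)\<^sup>2))"
      by (simp add: real_sqrt_mult)
    also have "\<dots> \<le> sqrt N * (3 ^ Suc k * (\<Sum>J\<in>Pow Q. \<bar>c (\<alpha> \<circ> swap_pairs J) \<beta>\<bar>))"
      using low by (intro mult_left_mono) (auto simp: N_def)
    finally show ?thesis by (simp only: mult_ac)
  qed
  have swap: "(\<Sum>\<alpha>\<in>bijs I V. \<Sum>\<beta>\<in>bijs I U. \<Sum>J\<in>Pow Q. \<bar>c (\<alpha> \<circ> swap_pairs J) \<beta>\<bar>) = 2 ^ card Q * Z"
  proof -
    have "(\<Sum>\<alpha>\<in>bijs I V. \<Sum>\<beta>\<in>bijs I U. \<Sum>J\<in>Pow Q. \<bar>c (\<alpha> \<circ> swap_pairs J) \<beta>\<bar>)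
        = (\<Sum>\<alpha>\<in>bijs I V. \<Sum>J\<in>Pow Q. \<Sum>\<beta>\<in>bijs I U. \<bar>c (\<alpha> \<circ> swap_pairs J) \<beta>\<bar>)"
      by (intro sum.cong refl sum.swap)
    also have "\<dots> = (\<Sum>J\<in>Pow Q. \<Sum>\<alpha>\<in>bijs I V. \<Sum>\<beta>\<in>bijs I U. \<bar>c (\<alpha> \<circ> swap_pairs J) \<beta>\<bar>)"
      by (rule sum.swap)
    also have "\<dots> = (\<Sum>J\<in>Pow Q. Z)"
    proof (rule sum.cong[OF refl])
      fix J assume "J \<in> Pow Q"
      then have "swap_pairs J permutes I" using pairs by (intro swap_pairs_permutes) blast
      then show "(\<Sum>\<alpha>\<in>bijs I V. \<Sum>\<beta>\<in>bijs I U. \<bar>c (\<alpha> \<circ> swap_pairs J) \<beta>\<bar>) = Z"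
        unfolding Z_def by (rule sum_bijs_comp)
    qed
    finally show ?thesis using P(2) by (simp add: card_Pow)
  qed
  \<comment> \<open>Here \<open>insert j T\<close> has r + 1 elements. Normalising the bound of
    \<open>sum_fourier_overlap_ge\<close> by the size of the cube leaves 2^(r+1), which is at most
    2^k.\<close>
  have level: "X \<le> 2 ^ k * (\<Sum>\<alpha>\<in>bijs I V. \<Sum>\<beta>\<in>bijs I U. \<bar>b \<alpha> \<beta> T\<bar>)" if T: "T \<in> ksub Q r" for T
  proof -
    have TQ: "T \<subseteq> Q" "card (insert j T) = Suc r" "finite T"
      using T jT[of T] P(2) by (auto simp: ksub_def intro: finite_subset)
    have le: "Suc r \<le> card (P \<union> Q)"
      using card_mono[of "P \<union> Q" "insert j T"] TQ P by auto
    have "2 ^ (card (P \<union> Q) - Suc r) * X \<le> (\<Sum>\<alpha>\<in>bijs I V. \<Sum>\<beta>\<in>bijs I U.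
        \<bar>\<Sum>J\<in>Pow (P \<union> Q). chi J (insert j T) * overlap k I w u (\<alpha> \<circ> swap_pairs J) \<beta>\<bar>)"
      using sum_fourier_overlap_ge[of "insert j T" I V U "P \<union> Q" k w u] fin P pairs r TQ
      unfolding X_def TQ(2) by (auto simp: mult_ac)
    also have "\<dots> = 2 ^ card (P \<union> Q) * (\<Sum>\<alpha>\<in>bijs I V. \<Sum>\<beta>\<in>bijs I U. \<bar>b \<alpha> \<beta> T\<bar>)"
      using TQ(1) by (simp add: b fourier_def abs_divide sum_distrib_left)
    also have "(2::real) ^ card (P \<union> Q) = 2 ^ (card (P \<union> Q) - Suc r) * 2 ^ Suc r"
      using le by (simp only: power_add[symmetric] le_add_diff_inverse2)
    finally have "X \<le> 2 ^ Suc r * (\<Sum>\<alpha>\<in>bijs I V. \<Sum>\<beta>\<in>bijs I U. \<bar>b \<alpha> \<beta> T\<bar>)"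
      by (simp only: mult.assoc) (simp del: power_Suc)
    also have "\<dots> \<le> 2 ^ k * (\<Sum>\<alpha>\<in>bijs I V. \<Sum>\<beta>\<in>bijs I U. \<bar>b \<alpha> \<beta> T\<bar>)"
      using r by (intro mult_right_mono power_increasing sum_nonneg) auto
    finally show ?thesis .
  qed
  have "2 ^ card Q * (N * X) = 2 ^ card Q * (\<Sum>T\<in>ksub Q r. X)"
    using P(2) by (simp add: N_def card_ksub)
  also have "\<dots> \<le> 2 ^ card Q * (\<Sum>T\<in>ksub Q r. 2 ^ k * (\<Sum>\<alpha>\<in>bijs I V. \<Sum>\<beta>\<in>bijs I U. \<bar>b \<alpha> \<beta> T\<bar>))"
    using level by (intro mult_left_mono sum_mono) auto
  also have "\<dots> = 2 ^ k * (\<Sum>\<alpha>\<in>bijs I V. \<Sum>\<beta>\<in>bijs I U. 2 ^ card Q * (\<Sum>T\<in>ksub Q r. \<bar>b \<alpha> \<beta> T\<bar>))"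
    by (simp only: sum_distrib_left sum.swap[of _ "ksub Q r" "bijs I V"] sum.swap[of _ "ksub Q r" "bijs I U"]
        mult.left_commute)
  also have "\<dots> \<le> 2 ^ k * (\<Sum>\<alpha>\<in>bijs I V. \<Sum>\<beta>\<in>bijs I U.
      3 ^ Suc k * sqrt N * (\<Sum>J\<in>Pow Q. \<bar>c (\<alpha> \<circ> swap_pairs J) \<beta>\<bar>))"
    using khin by (intro mult_left_mono sum_mono) auto
  also have "\<dots> = 2 ^ card Q * (sqrt N * (3 ^ Suc k * 2 ^ k * Z))"
    by (simp only: sum_distrib_left[symmetric] swap mult_ac)
  finally have main: "N * X \<le> sqrt N * (3 ^ Suc k * 2 ^ k * Z)" by (simp del: power_Suc)
  have "sqrt N * X \<le> 3 ^ Suc k * 2 ^ k * Z"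
  proof (cases "N = 0")
    case True
    then show ?thesis using Z0 by simp
  next
    case False
    then have "N > 0" by (simp add: N_def)
    then have "N * X = sqrt N * (sqrt N * X)" by simp
    then have "sqrt N * (sqrt N * X) \<le> sqrt N * (3 ^ Suc k * 2 ^ k * Z)"
      using main by (simp only:)
    then show ?thesis
      by (rule mult_left_le_imp_le) (use \<open>N > 0\<close> in simp)
  qed
  then show ?thesis by (simp add: N_def X_def Z_def c_def mult_ac)
qed

section \<open>The lower bound\<close>

lemma Wvec_nonneg: "Wvec k V w i \<ge> 0"
proof (induction k arbitrary: V w i)
  case 0
  then show ?case by (cases i) auto
next
  case (Suc k)
  have "real (card V) * (real (card V) - 1) \<ge> 0" by (cases "card V") auto
  then show ?case
    using Suc by (cases i) (auto intro!: sum_nonneg divide_nonneg_nonneg)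
qed

text \<open>After \<open>i\<close> differences there remain |V| - 2 i vertices and edges of size k -
  i. With fewer than k + i vertices either no pair can be chosen at some stage or the last binomial
  coefficient is 0, and division by 0 gives 0.\<close>

lemma Wvec_eq_0:
  assumes "finite V" "card V < k + i"
  shows "Wvec k V w i = 0"
  using assms
proof (induction i arbitrary: k V w)
  case 0
  then show ?case by (simp add: binomial_eq_0)
next
  case (Suc i)
  show ?case
  proof (cases k)
    case 0
    then show ?thesis by simp
  next
    case (Suc k')
    have "Wvec k' (V - {x, y}) (diffw w x y) i = 0" if "x \<in> V" "y \<in> V" "x \<noteq> y" for x y
    proof (rule Suc.IH)
      have "card {x, y} \<le> card V" using that Suc.prems by (intro card_mono) auto
      then show "card (V - {x, y}) < k' + i"
        using that Suc.prems \<open>k = Suc k'\<close> by (simp add: card_Diff_subset)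
    qed (use Suc.prems in auto)
    then have "(\<Sum>(x, y)\<in>{(x, y). x \<in> V \<and> y \<in> V \<and> x \<noteq> y}. Wvec k' (V - {x, y}) (diffw w x y) i) = 0"
      by (intro sum.neutral) auto
    then show ?thesis by (simp add: \<open>k = Suc k'\<close>)
  qed
qed

section \<open>Sizes of the two groups of pairs\<close>

lemma power_div_le_binomial:
  assumes "d \<le> m" "real d * n \<le> c * real m" "0 \<le> n" "0 < c"
  shows "(n / c) ^ d \<le> real (m choose d)"
proof (cases "d = 0")
  case False
  then have "n / c \<le> real m / real d" using assms by (simp add: field_simps)
  then have "(n / c) ^ d \<le> (real m / real d) ^ d"
    using assms by (intro power_mono) auto
  also have "\<dots> \<le> real (m choose d)"
    using binomial_ge_n_over_k_pow_k[OF assms(1), where 'a = real] by simp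
  finally show ?thesis .
qed simp

text \<open>Of the \<open>N\<close> pairs, \<open>p\<close> serve as \<open>P\<close> and the rest
  as \<open>Q\<close>. Taking p = N div i leaves none for \<open>Q\<close> when i = 1, where none
  are needed, and a number linear in \<open>n\<close> otherwise.\<close>

lemma pair_split_bound:
  assumes i: "1 \<le> i" "i \<le> k" "k + i \<le> n"
  defines "N \<equiv> n div 2"
  defines "p \<equiv> N div i"
  shows "p \<le> N" "real n ^ (2 * k + 1) / real n ^ i
    \<le> real (6 * k) ^ (2 * k + 1) * (real p)\<^sup>2 * real ((N - p) choose (i - 1))
      * (real ((n - 2 * i) choose (k - i)))\<^sup>2"
proof -
  \<comment> \<open>With this scale \<open>p\<close> is at least \<open>x\<close> and the two
    binomial coefficients are at least x^(i-1) and x^(k-i). The exponents 2, i - 1 and 2 (k - i) add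
    up to 2 k + 1 - i.\<close>
  define x where "x = real n / real (6 * k)"
  have k: "k \<ge> 1" and n: "n \<ge> 2" using i by auto
  have N: "n \<le> 3 * N" "i \<le> N" using i unfolding N_def by linarith+
  show "p \<le> N" by (simp add: p_def)
  have pi: "p * i \<le> N" "N < p * i + i" "1 \<le> p"
    using i N by (auto simp: p_def div_greater_zero_iff Suc_le_eq mult.commute[of _ i])
      (metis add.commute dividend_less_times_div less_le_trans zero_less_one)
  have x0: "x \<ge> 0" by (simp add: x_def)
  have "N \<le> 2 * (p * i)"
  proof -
    have "1 * i \<le> p * i" using pi(3) by (intro mult_right_mono) auto
    then show ?thesis using pi(2) by linarith
  qed
  also have "\<dots> \<le> 2 * (p * k)" using i by simp
  finally have "n \<le> p * (6 * k)" using N(1) by linarith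
  then have "real n \<le> real p * real (6 * k)" by (simp only: of_nat_mult[symmetric] of_nat_le_iff)
  then have xp: "x \<le> real p" using k by (simp add: x_def field_simps)
  have q: "i - 1 \<le> N - p" "(i - 1) * N \<le> i * (N - p)"
  proof -
    have eqs: "i * (N - p) = i * N - i * p" "(i - 1) * N = i * N - N"
      by (simp_all add: diff_mult_distrib diff_mult_distrib2)
    show *: "(i - 1) * N \<le> i * (N - p)"
      unfolding eqs using pi(1) by (intro diff_le_mono2) (simp add: mult.commute)
    have "i * (i - 1) \<le> (i - 1) * N" using N(2) by (simp add: mult.commute)
    then have "i * (i - 1) \<le> i * (N - p)" using * by linarith
    then show "i - 1 \<le> N - p" using i by simp
  qed
  have "x ^ (i - 1) \<le> real ((N - p) choose (i - 1))"
    unfolding x_def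
  proof (rule power_div_le_binomial)
    have "(i - 1) * n \<le> (i - 1) * (3 * N)" using N(1) by (intro mult_left_mono) auto
    also have "\<dots> \<le> 3 * (i * (N - p))" using q(2) by simp
    also have "\<dots> \<le> 6 * k * (N - p)" using i by (simp add: mult_le_mono)
    finally show "real (i - 1) * real n \<le> real (6 * k) * real (N - p)"
      by (simp only: of_nat_mult[symmetric] of_nat_le_iff)
  qed (use q k in auto)
  moreover have "x ^ (k - i) \<le> real ((n - 2 * i) choose (k - i))"
    unfolding x_def
  proof (rule power_div_le_binomial)
    define m where "m = n - 2 * i"
    have m: "n = m + 2 * i" "k - i \<le> m" using i by (auto simp: m_def)
    have "(k - i) * n = (k - i) * m + 2 * (i * (k - i))" by (simp add: m algebra_simps)
    also have "\<dots> \<le> k * m + 2 * (k * m)"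
      using m(2) i by (intro add_mono mult_le_mono) auto
    also have "\<dots> \<le> 6 * k * m" by simp
    finally show "real (k - i) * real n \<le> real (6 * k) * real (n - 2 * i)"
      by (simp only: of_nat_mult[symmetric] of_nat_le_iff m_def)
  qed (use i k in auto)
  ultimately have "x\<^sup>2 * x ^ (i - 1) * (x ^ (k - i))\<^sup>2
      \<le> (real p)\<^sup>2 * real ((N - p) choose (i - 1)) * (real ((n - 2 * i) choose (k - i)))\<^sup>2"
    using xp x0 by (intro mult_mono power_mono) auto
  also have "x\<^sup>2 * x ^ (i - 1) * (x ^ (k - i))\<^sup>2 = x ^ (2 * k + 1 - i)"
  proof -
    have "2 + (i - 1) + (k - i) * 2 = 2 * k + 1 - i" using i by simp
    then show ?thesis by (simp only: power_mult[symmetric] power_add[symmetric])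
  qed
  finally have main: "x ^ (2 * k + 1 - i)
      \<le> (real p)\<^sup>2 * real ((N - p) choose (i - 1)) * (real ((n - 2 * i) choose (k - i)))\<^sup>2" .
  have "real n ^ (2 * k + 1) / real n ^ i = real n ^ (2 * k + 1 - i)"
    using n i by (simp add: power_diff)
  also have "\<dots> = real (6 * k) ^ (2 * k + 1 - i) * x ^ (2 * k + 1 - i)"
  proof -
    have nx: "real (6 * k) * x = real n" using k by (simp add: x_def)
    show ?thesis by (simp only: power_mult_distrib[symmetric] nx)
  qed
  also have "\<dots> \<le> real (6 * k) ^ (2 * k + 1) * ((real p)\<^sup>2 * real ((N - p) choose (i - 1))
      * (real ((n - 2 * i) choose (k - i)))\<^sup>2)"
    using main k x0 by (intro mult_mono power_increasing) auto
  finally show "real n ^ (2 * k + 1) / real n ^ i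
    \<le> real (6 * k) ^ (2 * k + 1) * (real p)\<^sup>2 * real ((N - p) choose (i - 1))
      * (real ((n - 2 * i) choose (k - i)))\<^sup>2" by (simp only: mult.assoc)
qed

text \<open>Each level \<open>i\<close> is treated on its own, since the split into \<open>P\<close>
  and \<open>Q\<close> depends on \<open>i\<close>; the constant \<open>E\<close> does not.\<close>

lemma disc_product_ge_level:
  fixes k :: nat
  assumes "k \<ge> 1"
  obtains E where "E > 0"
    and "\<And>(V :: 'a set) w u. finite V \<Longrightarrow> 0 \<le> disc_plus V k w u * disc_minus V k w u"
    and "\<And>(V :: 'a set) w u i. finite V \<Longrightarrow> i \<in> {1..k} \<Longrightarrow>
      real (card V) ^ (2 * k + 1) / real (card V) ^ i * (Wvec k V w i * Wvec k V u i)\<^sup>2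
      \<le> E * (disc_plus V k w u * disc_minus V k w u)"
proof -
  obtain D where D: "D > 0" and poly: "\<forall>(A :: nat \<Rightarrow> real) m M. A 0 = 0 \<longrightarrow>
      (\<forall>p\<in>{-1..1}. - m \<le> (\<Sum>r\<le>k. A r * p ^ r) \<and> (\<Sum>r\<le>k. A r * p ^ r) \<le> M) \<longrightarrow>
      (A 1)\<^sup>2 \<le> D * (M * m)"
    using linear_coeff_le[OF assms] by blast
  define E where "E = real (6 * k) ^ (2 * k + 1) * (3 ^ Suc k * 2 ^ k)\<^sup>2 * D"
  have "E > 0" using D assms by (simp add: E_def)
  have prod0: "0 \<le> disc_plus V k w u * disc_minus V k w u"
    and level: "real (card V) ^ (2 * k + 1) / real (card V) ^ i * (Wvec k V w i * Wvec k V u i)\<^sup>2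
      \<le> E * (disc_plus V k w u * disc_minus V k w u)"
    if V: "finite V" and i: "i \<in> {1..k}" for V :: "'a set" and w u i
  proof -
    define n where "n = card V"
    define I where "I = {..<n}"
    define MM where "MM = disc_plus V k w u * disc_minus V k w u"
    have fin: "finite I" "finite V" "card I = card V" using V by (auto simp: I_def n_def)
    \<comment> \<open>With \<open>P\<close> empty the sum of linear coefficients is 0, so the
      general bound yields nonnegativity of the product.\<close>
    have "0 \<le> D * MM"
      using disc_product_ge_linear[OF poly fin, of "{}" w u] by (simp add: MM_def)
    then have MM0: "0 \<le> MM" using D by (simp add: zero_le_mult_iff)
    then show "0 \<le> disc_plus V k w u * disc_minus V k w u" by (simp add: MM_def)
    show "real (card V) ^ (2 * k + 1) / real (card V) ^ i * (Wvec k V w i * Wvec k V u i)\<^sup>2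
      \<le> E * (disc_plus V k w u * disc_minus V k w u)"
    proof (cases "n < k + i")
      \<comment> \<open>With too few vertices there is no room for \<open>i\<close> disjoint pairs
        and a further k - i indices, but then \<open>W_i\<close> is 0.\<close>
      case True
      then have "Wvec k V w i = 0" using V by (intro Wvec_eq_0) (auto simp: n_def)
      then show ?thesis using MM0 \<open>E > 0\<close> by (simp add: MM_def)
    next
      case False
      define N where "N = n div 2"
      define p where "p = N div i"
      define P where "P = {..<p}"
      define Q where "Q = {p..<N}"
      define F where "F = (fact n :: real)\<^sup>2"
      have F: "F > 0" by (simp add: F_def)
      have i': "1 \<le> i" "i \<le> k" "k + i \<le> n" using i False by auto
      note split = pair_split_bound[OF i', folded N_def, folded p_def]
      have PQ: "finite P" "finite Q" "P \<inter> Q = {}" "card P = p" "card Q = N - p"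
        by (auto simp: P_def Q_def)
      have pairs: "{2 * j, 2 * j + 1} \<subseteq> I" if "j \<in> P \<union> Q" for j
      proof -
        have "j < N" using that split(1) by (auto simp: P_def Q_def)
        then have "2 * j + 1 < n" unfolding N_def by linarith
        then show ?thesis by (auto simp: I_def)
      qed
      define bq where "bq = real ((N - p) choose (i - 1))"
      define bk where "bk = real ((n - 2 * i) choose (k - i))"
      define WU where "WU = Wvec k V w i * Wvec k V u i"
      define L where "L = (\<Sum>\<alpha>\<in>bijs I V. \<Sum>\<beta>\<in>bijs I V. \<Sum>j\<in>P.
        \<bar>fourier P (\<lambda>J. overlap k I w u (\<alpha> \<circ> swap_pairs J) \<beta>) {j}\<bar>)"
      have WU0: "WU \<ge> 0" by (simp add: WU_def Wvec_nonneg)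
      have one: "sqrt bq * bk * F * WU \<le> 3 ^ Suc k * 2 ^ k * (\<Sum>\<alpha>\<in>bijs I V. \<Sum>\<beta>\<in>bijs I V.
          \<bar>fourier P (\<lambda>J. overlap k I w u (\<alpha> \<circ> swap_pairs J) \<beta>) {j}\<bar>)" if "j \<in> P" for j
        using sum_linear_coeff_ge[OF fin(1,2,2,3,3) PQ(1-3) that pairs, of "i - 1" k w u] i' fin(3)
        by (simp add: bq_def bk_def F_def WU_def PQ n_def)
      \<comment> \<open>Every pair in \<open>P\<close> satisfies the same bound, so summing gains
        the factor \<open>p\<close>, which enters squared below.\<close>
      have "real p * (sqrt bq * bk * F * WU) = (\<Sum>j\<in>P. sqrt bq * bk * F * WU)"
        by (simp add: PQ)
      also have "\<dots> \<le> (\<Sum>j\<in>P. 3 ^ Suc k * 2 ^ k * (\<Sum>\<alpha>\<in>bijs I V. \<Sum>\<beta>\<in>bijs I V.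
          \<bar>fourier P (\<lambda>J. overlap k I w u (\<alpha> \<circ> swap_pairs J) \<beta>) {j}\<bar>))"
        by (rule sum_mono[OF one])
      also have "\<dots> = 3 ^ Suc k * 2 ^ k * L"
        unfolding L_def by (simp only: sum_distrib_left[symmetric] sum.swap[of _ P "bijs I V"])
      finally have "real p * sqrt bq * bk * WU \<le> 3 ^ Suc k * 2 ^ k * (L / F)"
        using F by (simp add: field_simps)
      then have "(real p * sqrt bq * bk * WU)\<^sup>2 \<le> (3 ^ Suc k * 2 ^ k * (L / F))\<^sup>2"
        using WU0 by (intro power_mono) (auto simp: bq_def bk_def)
      also have "\<dots> = (3 ^ Suc k * 2 ^ k)\<^sup>2 * (L / F)\<^sup>2"
        by (rule power_mult_distrib)
      also have "(L / F)\<^sup>2 \<le> D * MM"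
        unfolding L_def F_def MM_def n_def
        by (rule disc_product_ge_linear[OF poly fin PQ(1)]) (use pairs in auto)
      finally have step: "(real p)\<^sup>2 * bq * bk\<^sup>2 * WU\<^sup>2 \<le> (3 ^ Suc k * 2 ^ k)\<^sup>2 * (D * MM)"
        by (simp add: power_mult_distrib bq_def)
      have "real n ^ (2 * k + 1) / real n ^ i * WU\<^sup>2
          \<le> real (6 * k) ^ (2 * k + 1) * (real p)\<^sup>2 * bq * bk\<^sup>2 * WU\<^sup>2"
        using split(2) unfolding bq_def bk_def by (intro mult_right_mono) auto
      also have "\<dots> = real (6 * k) ^ (2 * k + 1) * ((real p)\<^sup>2 * bq * bk\<^sup>2 * WU\<^sup>2)"
        by (simp only: mult.assoc)
      also have "\<dots> \<le> real (6 * k) ^ (2 * k + 1) * ((3 ^ Suc k * 2 ^ k)\<^sup>2 * (D * MM))"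
        using step by (intro mult_left_mono) auto
      also have "\<dots> = E * MM" by (simp only: E_def mult.assoc)
      finally show ?thesis by (simp only: n_def WU_def MM_def)
    qed
  qed
  show thesis
  proof (rule that[of E])
    fix V :: "'a set" and w u assume "finite V"
    then show "0 \<le> disc_plus V k w u * disc_minus V k w u"
      by (rule prod0[of V k]) (use assms in simp)
  qed (fact \<open>E > 0\<close>, rule level)
qed

lemma disc_plus_minus_sum_nonneg:
  assumes "finite V"
  shows "0 \<le> disc_plus V k w u + disc_minus V k w u"
proof -
  let ?X = "{permip V k \<pi> w u | \<pi>. \<pi> permutes V}"
  have "finite ?X" using finite_permutations[OF assms] by simp
  moreover have "permip V k id w u \<in> ?X" using permutes_id by blast
  ultimately have "Min ?X \<le> Max ?X" by (meson Max_ge Min_le order_trans)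
  then show ?thesis by (simp add: disc_plus_def disc_minus_def)
qed

text \<open>Both inequalities come from the bound for single levels: the first by adding the
  \<open>k\<close> levels, the second by taking square roots at each level before adding. The sums
  cost the factor \<open>k\<close> in \<open>c\<close> and \<open>c'\<close>.\<close>

theorem theorem1p3:
  fixes k :: nat
  assumes "k \<ge> 1"
  shows "\<exists>c > 0. \<exists>c' > 0. \<forall>n \<ge> k. \<forall>w u :: nat set \<Rightarrow> real.
    disc_plus {1..n} k w u * disc_minus {1..n} k w u
      \<ge> c * real n ^ (2 * k + 1) *
         (\<Sum>i = 1..k. Wvec k {1..n} w i ^ 2 * Wvec k {1..n} u i ^ 2 / real n ^ i)
    \<and> disc {1..n} k w u
      \<ge> c' * real n powr (real k + 1 / 2) *
         (\<Sum>i = 1..k. real n powr (- real i / 2) * Wvec k {1..n} w i * Wvec k {1..n} u i)"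
proof -
  obtain E where E: "E > 0"
    and prod0: "\<And>V w u. finite (V :: nat set) \<Longrightarrow> 0 \<le> disc_plus V k w u * disc_minus V k w u"
    and level: "\<And>V w u i. finite (V :: nat set) \<Longrightarrow> i \<in> {1..k} \<Longrightarrow>
      real (card V) ^ (2 * k + 1) / real (card V) ^ i * (Wvec k V w i * Wvec k V u i)\<^sup>2
      \<le> E * (disc_plus V k w u * disc_minus V k w u)"
    by (fact disc_product_ge_level[OF assms, where 'a = nat])
  define c where "c = 1 / (real k * E)"
  define c' where "c' = 1 / (real k * sqrt E)"
  have k: "real k > 0" using assms by simp
  have "c * real n ^ (2 * k + 1) *
         (\<Sum>i = 1..k. Wvec k {1..n} w i ^ 2 * Wvec k {1..n} u i ^ 2 / real n ^ i)
      \<le> disc_plus {1..n} k w u * disc_minus {1..n} k w u"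
    and "c' * real n powr (real k + 1 / 2) *
         (\<Sum>i = 1..k. real n powr (- real i / 2) * Wvec k {1..n} w i * Wvec k {1..n} u i)
      \<le> disc {1..n} k w u"
    if n: "n \<ge> k" for n and w u :: "nat set \<Rightarrow> real"
  proof -
    define M where "M = disc_plus {1..n} k w u"
    define m where "m = disc_minus {1..n} k w u"
    define W where "W i = Wvec k {1..n} w i" for i
    define U where "U i = Wvec k {1..n} u i" for i
    have n0: "real n > 0" using n assms by simp
    have lev: "real n ^ (2 * k + 1) / real n ^ i * (W i * U i)\<^sup>2 \<le> E * (M * m)" if "i \<in> {1..k}" for i
      using level[of "{1..n}" i w u] that by (simp add: W_def U_def M_def m_def)
    have "real n ^ (2 * k + 1) * (\<Sum>i = 1..k. W i ^ 2 * U i ^ 2 / real n ^ i)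
        = (\<Sum>i = 1..k. real n ^ (2 * k + 1) / real n ^ i * (W i * U i)\<^sup>2)"
      by (simp add: sum_distrib_left power_mult_distrib)
    also have "\<dots> \<le> (\<Sum>i = 1..k. E * (M * m))"
      by (rule sum_mono[OF lev])
    also have "\<dots> = real k * E * (M * m)" by simp
    finally have "c * (real n ^ (2 * k + 1) * (\<Sum>i = 1..k. W i ^ 2 * U i ^ 2 / real n ^ i))
        \<le> c * (real k * E * (M * m))"
      using k E by (intro mult_left_mono) (auto simp: c_def)
    also have "\<dots> = M * m" using k E by (simp add: c_def)
    finally show "c * real n ^ (2 * k + 1) *
         (\<Sum>i = 1..k. Wvec k {1..n} w i ^ 2 * Wvec k {1..n} u i ^ 2 / real n ^ i)
      \<le> disc_plus {1..n} k w u * disc_minus {1..n} k w u"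
      by (simp add: W_def U_def M_def m_def mult.assoc)
    define d where "d = max M m"
    have Mm: "0 \<le> M * m" "0 \<le> M + m"
      using prod0[of "{1..n}" w u] disc_plus_minus_sum_nonneg[of "{1..n}" k w u]
      by (simp_all add: M_def m_def)
    \<comment> \<open>A nonnegative product together with a nonnegative sum makes both factors
      nonnegative, so the product is at most the square of the larger one.\<close>
    then have "0 \<le> M" "0 \<le> m" by (auto simp: zero_le_mult_iff)
    then have d: "0 \<le> d" "M * m \<le> d\<^sup>2"
      by (auto simp: d_def power2_eq_square intro: mult_mono)
    have "real n powr (real k + 1 / 2) * (real n powr (- real i / 2) * W i * U i) \<le> sqrt E * d"
      if i: "i \<in> {1..k}" for i
    proof (rule power2_le_imp_le)
      \<comment> \<open>Squaring turns the real exponents k + 1/2 and - i/2 into the integer powers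
        of the level bound; n > 0 makes \<open>powr\<close> agree with them.\<close>
      have "(real n powr (real k + 1 / 2) * (real n powr (- real i / 2)))\<^sup>2
          = (real n powr (real k + 1 / 2 - real i / 2))\<^sup>2"
        by (simp add: powr_add[symmetric])
      also have "\<dots> = real n powr (real (2 * k + 1) - real i)"
        by (simp add: power2_eq_square powr_add[symmetric] algebra_simps)
      also have "\<dots> = real n ^ (2 * k + 1) / real n ^ i"
        using n0 by (simp only: powr_diff powr_realpow)
      finally have "(real n powr (real k + 1 / 2) * (real n powr (- real i / 2) * W i * U i))\<^sup>2
          = real n ^ (2 * k + 1) / real n ^ i * (W i * U i)\<^sup>2"
        by (simp only: mult.assoc[symmetric] power_mult_distrib)
      also have "\<dots> \<le> E * d\<^sup>2"
        using lev[OF i] d(2) E by (meson mult_left_mono order_trans less_imp_le)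
      also have "\<dots> = (sqrt E * d)\<^sup>2" using E by (simp add: power_mult_distrib)
      finally show "(real n powr (real k + 1 / 2) * (real n powr (- real i / 2) * W i * U i))\<^sup>2
          \<le> (sqrt E * d)\<^sup>2" .
    qed (use E d in auto)
    then have "(\<Sum>i = 1..k. real n powr (real k + 1 / 2) * (real n powr (- real i / 2) * W i * U i))
        \<le> (\<Sum>i = 1..k. sqrt E * d)"
      by (intro sum_mono)
    then have "real n powr (real k + 1 / 2) * (\<Sum>i = 1..k. real n powr (- real i / 2) * W i * U i)
        \<le> real k * sqrt E * d"
      by (simp add: sum_distrib_left)
    then have "c' * (real n powr (real k + 1 / 2) * (\<Sum>i = 1..k. real n powr (- real i / 2) * W i * U i))
        \<le> c' * (real k * sqrt E * d)"
      using k E by (intro mult_left_mono) (auto simp: c'_def)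
    also have "\<dots> = d" using k E by (simp add: c'_def)
    finally show "c' * real n powr (real k + 1 / 2) *
         (\<Sum>i = 1..k. real n powr (- real i / 2) * Wvec k {1..n} w i * Wvec k {1..n} u i)
      \<le> disc {1..n} k w u"
      by (simp add: W_def U_def d_def M_def m_def disc_def mult.assoc)
  qed
  moreover have "c > 0" "c' > 0" using k E by (auto simp: c_def c'_def)
  ultimately show ?thesis by blast
qed

end
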